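(* For every planar graph $G$, $\operatorname{diam}(\mathcal{I}(G)) \leq 12$.
   Context: Graphs are finite and simple. In an orientation $\vec{G}$ of a graph $G$, the inversion of a set $X \subseteq V(G)$ consists in reversing all arcs with both endvertices in $X$. The inversion graph $\mathcal{I}(G)$ is the graph whose vertices are the labelled orientations of $G$, two orientations being adjacent if and only if the inversion of some $X\subseteq V(G)$ transforms one into the other; $\operatorname{diam}(\mathcal{I}(G))$ is its diameter. *)

theory Defs
  imports "HOL-Analysis.Analysis" "Graph_Theory.Graph_Theory"
begin

text \<open>
  Finite simple graphs are the \<^locale>\<open>pair_graph\<close>s of the Graph_Theory library: an edge between
  \<open>u\<close> and \<open>v\<close> is represented by the two opposite pairs \<open>(u, v)\<close> and \<open>(v, u)\<close>.
\<close>

definition is_orientation :: "'a pair_pre_digraph \<Rightarrow> 'a pair_pre_digraph \<Rightarrow> bool" where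
  "is_orientation G D \<longleftrightarrow>
     pverts D = pverts G \<and> parcs D \<subseteq> parcs G \<and>
     (\<forall>(u, v)\<in>parcs G. (u, v) \<in> parcs D \<longleftrightarrow> (v, u) \<notin> parcs D)"

definition inversion :: "'a set \<Rightarrow> 'a pair_pre_digraph \<Rightarrow> 'a pair_pre_digraph" where
  "inversion X D =
     D\<lparr>parcs := (\<lambda>(u, v). if u \<in> X \<and> v \<in> X then (v, u) else (u, v)) ` parcs D\<rparr>"

text \<open>
  Orientations are labelled: they are compared by equality, not up to isomorphism. The condition
  \<open>D \<noteq> D'\<close> excludes the loops that inversions of arcless sets would create.
\<close>

definition inversion_graph :: "'a pair_pre_digraph \<Rightarrow> 'a pair_pre_digraph pair_pre_digraph" where
  "inversion_graph G =
     \<lparr>pverts = {D. is_orientation G D},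
      parcs = {(D, D'). is_orientation G D \<and> is_orientation G D' \<and> D \<noteq> D' \<and>
                        (\<exists>X\<subseteq>pverts G. inversion X D = D')}\<rparr>"

text \<open>The distance is \<open>\<infinity>\<close> between vertices that no walk connects.\<close>

definition graph_dist :: "'a pair_pre_digraph \<Rightarrow> 'a \<Rightarrow> 'a \<Rightarrow> ereal" where
  "graph_dist G = wf_digraph.\<mu> (with_proj G) (\<lambda>_. 1)"

definition diam :: "'a pair_pre_digraph \<Rightarrow> ereal" where
  "diam G = (SUP u\<in>pverts G. SUP v\<in>pverts G. graph_dist G u v)"

text \<open>
  A drawing places the vertices at distinct points of the plane (identified with
  \<^typ>\<open>complex\<close>) and draws each edge as an arc between its ends whose interior contains no vertex
  and no point of another edge. The two pairs representing an edge carry the same arc, traversed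
  in opposite directions.
\<close>

definition plane_drawing ::
    "'a pair_pre_digraph \<Rightarrow> ('a \<Rightarrow> complex) \<Rightarrow> ('a \<times> 'a \<Rightarrow> real \<Rightarrow> complex) \<Rightarrow> bool" where
  "plane_drawing G pos \<gamma> \<longleftrightarrow>
     inj_on pos (pverts G) \<and>
     (\<forall>(u, v)\<in>parcs G.
        arc (\<gamma> (u, v)) \<and> pathstart (\<gamma> (u, v)) = pos u \<and> pathfinish (\<gamma> (u, v)) = pos v \<and>
        \<gamma> (v, u) = reversepath (\<gamma> (u, v)) \<and>
        \<gamma> (u, v) ` {0<..<1} \<inter> pos ` pverts G = {}) \<and>
     (\<forall>(u, v)\<in>parcs G. \<forall>(x, y)\<in>parcs G. {u, v} \<noteq> {x, y} \<longrightarrow>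
        \<gamma> (u, v) ` {0<..<1} \<inter> path_image (\<gamma> (x, y)) = {})"

definition planar :: "'a pair_pre_digraph \<Rightarrow> bool" where
  "planar G \<longleftrightarrow> (\<exists>pos \<gamma>. plane_drawing G pos \<gamma>)"

text \<open>
  \<^const>\<open>wf_digraph.\<mu>\<close> is meaningful only for well-formed digraphs.
\<close>

lemma wf_inversion_graph: "pair_wf_digraph (inversion_graph G)"
  by unfold_locales (auto simp: inversion_graph_def)

end

theory Submission
  imports Defs
begin

text \<open>
  Two orientations are at distance at most \<open>t\<close> if the vertices carry vectors over the field with two
  elements, of length \<open>t\<close>, whose scalar product along each edge says whether the edge must be
  reversed: the \<open>i\<close>-th inversion takes the vertices whose vector has a one at position \<open>i\<close>. The
  vectors are chosen greedily, keeping the following invariant: the vectors of the already treated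
  neighbours of an untreated vertex are linearly independent. If \<open>u\<close> has \<open>d\<close> treated neighbours,
  there are then \<open>2\<^bsup>t - d\<^esup>\<close> vectors with the right scalar products, and \<open>u\<close> must avoid the sums of
  treated neighbours of each untreated neighbour.

  The order is built from its end. If \<open>U\<close> is the set of vertices that are still to be placed, Euler's
  formula bounds the edges in \<open>U\<close>, the edges between \<open>U\<close> and the vertices outside with at least
  three neighbours in \<open>U\<close> (bipartite, girth four), and the pairs that are the neighbourhood in \<open>U\<close>
  of a vertex outside (girth six). Averaging over \<open>U\<close> a combination of the three counts gives a
  vertex with at most six neighbours in \<open>U\<close> and less than \<open>2\<^bsup>12 - d\<^esup>\<close> vectors to avoid.

  For topological drawings, the Euler inequality follows by removing edges: by the Jordan curve
  theorem, an edge on a cycle separates two faces. By Janiszewski's theorem an edge is on the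
  boundary of at most two faces, and a forest does not separate the plane.
\<close>

hide_const (open) Digraph_Component.connected

section \<open>Arcs in the plane\<close>

text \<open>An edge is represented by the image of its arc; its ends are its points in \<open>V\<close>.\<close>

definition plane_arcs :: "complex set \<Rightarrow> complex set set \<Rightarrow> bool" where
  "plane_arcs V E \<longleftrightarrow> finite V \<and> finite E \<and>
     (\<forall>K\<in>E. \<exists>g. arc g \<and> path_image g = K \<and> K \<inter> V = {pathstart g, pathfinish g}) \<and>
     (\<forall>K\<in>E. \<forall>L\<in>E. K \<noteq> L \<longrightarrow> K \<inter> L \<subseteq> V)"

definition support :: "complex set \<Rightarrow> complex set set \<Rightarrow> complex set" where
  "support V E = V \<union> \<Union>E"

definition faces :: "complex set \<Rightarrow> complex set set \<Rightarrow> complex set set" where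
  "faces V E = components (- support V E)"

text \<open>Vertices are left out of the arc because a face can reach an end of \<open>K\<close>
  without lying along \<open>K\<close>.\<close>

definition touches :: "complex set \<Rightarrow> complex set \<Rightarrow> complex set \<Rightarrow> bool" where
  "touches V A K \<longleftrightarrow> closure A \<inter> (K - V) \<noteq> {}"

text \<open>A vertex is always joined to itself, so \<open>a\<close> and \<open>b\<close> are the
  two distinct ends of \<open>K\<close>. Path components suit both the theorems on the plane and the
  counting of components.\<close>

definition bridge :: "complex set \<Rightarrow> complex set set \<Rightarrow> complex set \<Rightarrow> bool" where
  "bridge V E K \<longleftrightarrow> (\<exists>a\<in>K \<inter> V. \<exists>b\<in>K \<inter> V. \<not> path_component (support V (E - {K})) a b)"

text \<open>Forests, characterised without mentioning cycles.\<close>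

definition acyclic_arcs :: "complex set \<Rightarrow> complex set set \<Rightarrow> bool" where
  "acyclic_arcs V E \<longleftrightarrow> (\<forall>K\<in>E. bridge V E K)"

section \<open>Elementary properties of plane arcs\<close>

lemma plane_arcs_subset:
  assumes "plane_arcs V E" "F \<subseteq> E"
  shows "plane_arcs V F"
  using assms unfolding plane_arcs_def by (meson finite_subset subset_iff)

lemma plane_arcsE:
  assumes "plane_arcs V E" "K \<in> E"
  obtains g where "arc g" "path_image g = K" "K \<inter> V = {pathstart g, pathfinish g}"
    "pathstart g \<noteq> pathfinish g"
  using assms unfolding plane_arcs_def by (metis arc_distinct_ends)

lemma support_remove:
  assumes "K \<in> E"
  shows "support V E = support V (E - {K}) \<union> K"
  using assms by (auto simp: support_def)

lemma support_mono: "F \<subseteq> E \<Longrightarrow> support V F \<subseteq> support V E"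
  by (auto simp: support_def)

lemma compact_support:
  assumes "plane_arcs V E"
  shows "compact (support V E)"
proof -
  have "compact K" if "K \<in> E" for K
    using that assms by (metis compact_arc_image plane_arcsE)
  moreover have "finite V" "finite E" using assms by (auto simp: plane_arcs_def)
  ultimately show ?thesis
    unfolding support_def by (simp add: compact_Un compact_Union finite_imp_compact)
qed

lemma open_face:
  assumes "plane_arcs V E" "A \<in> faces V E"
  shows "open A"
  using assms unfolding faces_def
  by (meson compact_imp_closed compact_support open_Compl open_components)

lemma arc_meets_rest:
  assumes "plane_arcs V E" "K \<in> E"
  shows "K \<inter> support V (E - {K}) = K \<inter> V"
  using assms by (auto simp: plane_arcs_def support_def)

lemma connected_arc_interior:
  assumes "plane_arcs V E" "K \<in> E"
  shows "connected (K - V)"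
proof -
  obtain g where g: "arc g" "path_image g = K" "K \<inter> V = {pathstart g, pathfinish g}"
    using assms by (metis plane_arcsE)
  then have "K - V = path_image g - {pathstart g, pathfinish g}" by blast
  then show ?thesis
    using g(1) by (simp add: arc_imp_simple_path connected_simple_path_endless)
qed

lemma arc_interior_nonempty:
  assumes "plane_arcs V E" "K \<in> E"
  shows "K - V \<noteq> {}"
proof -
  obtain g where g: "arc g" "path_image g = K" "K \<inter> V = {pathstart g, pathfinish g}"
    using assms by (metis plane_arcsE)
  then have "K - V = path_image g - {pathstart g, pathfinish g}" by blast
  then show ?thesis
    using nonempty_simple_path_endless[OF arc_imp_simple_path[OF g(1)]] by (simp only: not_False_eq_True)
qed

text \<open>The inverse of the arc would map a plane open set continuously and injectively into the
  line, against invariance of dimension.\<close>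

lemma open_not_subset_arc_image:
  fixes g :: "real \<Rightarrow> complex"
  assumes "arc g" "open B" "B \<noteq> {}"
  shows "\<not> B \<subseteq> path_image g"
proof
  assume B: "B \<subseteq> path_image g"
  obtain h where h: "homeomorphism {0..1} (path_image g) g h"
    using assms(1) homeomorphism_arc by blast
  have "continuous_on B h"
    using h B by (meson continuous_on_subset homeomorphism_cont2)
  moreover have "inj_on h B"
    using h B by (metis homeomorphism_apply2 inj_onI subsetD)
  ultimately have "DIM(complex) \<le> DIM(real)"
    using invariance_of_dimension assms by blast
  then show False by simp
qed

text \<open>Each face stays connected when the interior of \<open>K\<close> is added, since it has a
  limit point there. The two enlarged sets overlap in that interior and avoid all the rest.\<close>

lemma connected_component_of_touching_faces:
  assumes E: "plane_arcs V E" "K \<in> E"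
    and A: "A \<in> faces V E" "touches V A K" "a \<in> A"
    and B: "B \<in> faces V E" "touches V B K" "b \<in> B"
  shows "connected_component (- support V (E - {K})) a b"
proof -
  have *: "connected (A \<union> (K - V))" if A: "A \<in> faces V E" "touches V A K" for A
  proof -
    obtain x where x: "x \<in> closure A" "x \<in> K - V"
      using A by (auto simp: touches_def)
    have "connected A" using A in_components_connected unfolding faces_def by blast
    then have "connected (insert x A)"
      by (rule connected_intermediate_closure) (use x closure_subset[of A] in \<open>simp_all add: subset_insertI\<close>)
    then have "connected (insert x A \<union> (K - V))"
      using x connected_arc_interior[OF E] by (intro connected_Un) auto
    then show ?thesis using x by (simp add: insert_absorb)
  qed
  have "connected ((A \<union> (K - V)) \<union> (B \<union> (K - V)))"
    using arc_interior_nonempty[OF E] by (intro connected_Un[OF *[OF A(1,2)] *[OF B(1,2)]]) blast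
  moreover have "C \<subseteq> - support V (E - {K})" if "C \<in> faces V E" for C
    using that in_components_subset[of C "- support V E"] support_mono[of "E - {K}" E V]
    unfolding faces_def by auto
  moreover have "K - V \<subseteq> - support V (E - {K})"
    using arc_meets_rest[OF E] by blast
  ultimately show ?thesis
    using A B unfolding connected_component_def
    by (intro exI[of _ "(A \<union> (K - V)) \<union> (B \<union> (K - V))"]) auto
qed

text \<open>A member that meets the path component lies inside it, so the component and its
  complement are both finite unions of members. Janiszewski's theorem needs them closed.\<close>

lemma closed_path_component_finite_Union:
  fixes \<C> :: "'a::real_normed_vector set set"
  assumes "finite \<C>" "\<And>C. C \<in> \<C> \<Longrightarrow> closed C \<and> path_connected C"
  shows "closed (path_component_set (\<Union>\<C>) x)" "closed (\<Union>\<C> - path_component_set (\<Union>\<C>) x)"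
proof -
  let ?P = "path_component_set (\<Union>\<C>) x"
  have sub: "C \<subseteq> ?P" if "C \<in> \<C>" "C \<inter> ?P \<noteq> {}" for C
  proof
    fix y assume "y \<in> C"
    obtain z where z: "z \<in> C" "z \<in> ?P" using \<open>C \<inter> ?P \<noteq> {}\<close> by (meson IntE ex_in_conv)
    then have "path_component C z y"
      using assms(2)[OF \<open>C \<in> \<C>\<close>] \<open>y \<in> C\<close> by (simp add: path_connected_component)
    then have "path_component (\<Union>\<C>) z y"
      using \<open>C \<in> \<C>\<close> path_component_of_subset by blast
    then show "y \<in> ?P" using z path_component_trans by blast
  qed
  have "?P \<subseteq> \<Union>\<C>" by (rule path_component_subset)
  then have eq: "?P = \<Union>{C\<in>\<C>. C \<inter> ?P \<noteq> {}}" "\<Union>\<C> - ?P = \<Union>{C\<in>\<C>. C \<inter> ?P = {}}"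
    using sub by blast+
  show "closed ?P"
    by (subst eq(1)) (use assms in \<open>auto intro!: closed_Union\<close>)
  show "closed (\<Union>\<C> - ?P)"
    by (subst eq(2)) (use assms in \<open>auto intro!: closed_Union\<close>)
qed

lemma closed_path_component_support:
  assumes "plane_arcs V E"
  shows "closed (path_component_set (support V E) x)"
    "closed (support V E - path_component_set (support V E) x)"
proof -
  \<comment> \<open>Vertices enter as singletons because an isolated one lies on no arc.\<close>
  let ?C = "(\<lambda>v. {v}) ` V \<union> E"
  have "\<Union>?C = support V E" by (auto simp: support_def)
  moreover have "finite ?C" using assms by (auto simp: plane_arcs_def)
  moreover have "closed C \<and> path_connected C" if "C \<in> ?C" for C
    using that
  proof
    assume "C \<in> E"
    then obtain g where "arc g" "path_image g = C" using assms by (metis plane_arcsE)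
    then show ?thesis
      by (metis arc_imp_path closed_arc_image path_connected_path_image)
  qed auto
  ultimately show "closed (path_component_set (support V E) x)"
    "closed (support V E - path_component_set (support V E) x)"
    using closed_path_component_finite_Union[of ?C x] by simp_all
qed

text \<open>Janiszewski's theorem, applied twice: a bridge meets each of the two parts that it joins in a
  single point.\<close>

lemma bridge_not_separating:
  assumes E: "plane_arcs V E" "K \<in> E" and br: "bridge V E K"
    and xy: "connected_component (- support V (E - {K})) x y" "x \<notin> K" "y \<notin> K"
  shows "connected_component (- support V E) x y"
proof -
  let ?D = "support V (E - {K})"
  obtain g where g: "arc g" "path_image g = K" "K \<inter> V = {pathstart g, pathfinish g}"
    using E by (metis plane_arcsE)
  obtain a b where ab: "a \<in> K \<inter> V" "b \<in> K \<inter> V" "\<not> path_component ?D a b"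
    using br by (auto simp: bridge_def)
  have E': "plane_arcs V (E - {K})" using E plane_arcs_subset by blast
  let ?P = "path_component_set ?D a"
  have a: "a \<in> ?P"
    using ab by (auto simp: support_def path_component_refl_eq)
  then have "a \<noteq> b" using ab by auto
  then have KV: "K \<inter> V = {a, b}" using g ab by auto
  have cK: "connected_component (- K) x y"
    using g xy connected_arc_complement[of g]
    by (metis ComplI DIM_complex connected_iff_connected_component order_refl)
  have PD: "?P \<subseteq> ?D" by (rule path_component_subset)
  have KD: "K \<inter> ?D = {a, b}" using arc_meets_rest[OF E] KV by simp
  have KP: "K \<inter> ?P = {a}" using KD PD a ab(3) by auto
  have clP: "closed ?P" "closed (?D - ?P)" using closed_path_component_support[OF E'] by auto
  have cK': "compact K" using g by (metis compact_arc_image)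
  have "compact ?P" using clP PD compact_support[OF E'] by (meson compact_eq_bounded_closed bounded_subset)
  have "- ?D \<subseteq> - ?P" "- ?D \<subseteq> - (?D - ?P)" using PD by auto
  then have c: "connected_component (- ?P) x y" "connected_component (- (?D - ?P)) x y"
    using connected_component_of_subset xy(1) by blast+
  have "connected_component (- (K \<union> ?P)) x y"
    using cK' clP cK c KP by (intro Janiszewski) auto
  moreover have "(K \<union> ?P) \<inter> (?D - ?P) = {b}" using KD KP a ab(3) by auto
  ultimately have "connected_component (- ((K \<union> ?P) \<union> (?D - ?P))) x y"
    using compact_Un[OF cK' \<open>compact ?P\<close>] clP(2) c(2)
    by (intro Janiszewski[of "K \<union> ?P"]) (simp_all only: connected_sing)
  moreover have "(K \<union> ?P) \<union> (?D - ?P) = support V E"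
    using support_remove[OF E(2)] PD by blast
  ultimately show ?thesis by simp
qed

lemma faces_eqI:
  assumes "A \<in> faces V E" "B \<in> faces V E" "a \<in> A" "b \<in> B"
    and "connected_component (- support V E) a b"
  shows "A = B"
proof -
  obtain C where "connected C" "C \<subseteq> - support V E" "a \<in> C" "b \<in> C"
    using assms(5) unfolding connected_component_def by blast
  then have "C \<subseteq> A"
    using assms components_maximal[of A "- support V E" C] unfolding faces_def by auto
  then have "A \<inter> B \<noteq> {}" using \<open>b \<in> C\<close> assms(4) by auto
  then show ?thesis
    using assms(1,2) components_nonoverlap[of A "- support V E" B] unfolding faces_def by simp
qed

text \<open>An arc in the rest joins the ends of \<open>K\<close> and closes it to a simple curve.
  The curve meets the rest exactly in that arc; Janiszewski's theorem asks for this connected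
  intersection.\<close>

lemma closing_curve:
  assumes E: "plane_arcs V E" "K \<in> E" and "\<not> bridge V E K"
  obtains c where "simple_path c" "pathfinish c = pathstart c" "K \<subseteq> path_image c"
    "path_image c \<subseteq> support V E"
    "connected (path_image c \<inter> support V (E - {K}))"
proof -
  let ?D = "support V (E - {K})"
  obtain g where g: "arc g" "path_image g = K" "K \<inter> V = {pathstart g, pathfinish g}"
      "pathstart g \<noteq> pathfinish g"
    using E by (metis plane_arcsE)
  then have "path_component ?D (pathfinish g) (pathstart g)"
    using assms(3) by (auto simp: bridge_def)
  then obtain p where p: "path p" "path_image p \<subseteq> ?D" "pathstart p = pathfinish g"
      "pathfinish p = pathstart g"
    unfolding path_component_def by blast
  then obtain f where f: "arc f" "path_image f \<subseteq> ?D" "pathstart f = pathfinish g"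
      "pathfinish f = pathstart g"
    using path_contains_arc[OF p(1,3,4)] g(4) by (metis subset_trans)
  have KD: "K \<inter> ?D = {pathstart g, pathfinish g}" using arc_meets_rest[OF E] g by simp
  have ends: "{pathstart g, pathfinish g} \<subseteq> path_image f"
    using f by (metis empty_subsetI insert_subset pathfinish_in_path_image pathstart_in_path_image)
  have I: "path_image g \<inter> path_image f = {pathstart g, pathfinish g}"
    using KD ends f(2) unfolding g(2) by blast
  have J: "(K \<union> path_image f) \<inter> ?D = path_image f"
    using KD ends f(2) by blast
  have img: "path_image (g +++ f) = K \<union> path_image f"
    using f g by (simp add: path_image_join)
  show thesis
  proof
    show "simple_path (g +++ f)"
      using f g I by (intro simple_path_join_loop) auto
    show "pathfinish (g +++ f) = pathstart (g +++ f)" using f by simp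
    show "K \<subseteq> path_image (g +++ f)" "path_image (g +++ f) \<subseteq> support V E"
      using img f support_remove[OF E(2), of V] by auto
    show "connected (path_image (g +++ f) \<inter> ?D)"
      using img J f(1) by (simp add: connected_arc_image)
  qed
qed

text \<open>Deleting \<open>K\<close> merges all faces along it. If \<open>K\<close> is a bridge,
  they were a single face already. Otherwise each of the two sides of the closing curve meets at
  most one of them.\<close>

lemma card_touching_faces_le:
  assumes E: "plane_arcs V E" "K \<in> E"
  shows "finite {A \<in> faces V E. touches V A K} \<and> card {A \<in> faces V E. touches V A K} \<le> 2"
proof -
  let ?T = "{A \<in> faces V E. touches V A K}"
  let ?D = "support V (E - {K})"
  have ne: "\<exists>a. a \<in> A" if "A \<in> faces V E" for A
    using that in_components_nonempty unfolding faces_def by fastforce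
  have notK: "x \<notin> K" if "A \<in> faces V E" "x \<in> A" for A x
    using that in_components_subset[of A "- support V E"] E(2) by (auto simp: faces_def support_def)
  show ?thesis
  proof (cases "bridge V E K")
    case True
    have "A = B" if A: "A \<in> faces V E" "touches V A K" and B: "B \<in> faces V E" "touches V B K" for A B
    proof -
      obtain a b where ab: "a \<in> A" "b \<in> B" using ne[OF A(1)] ne[OF B(1)] by auto
      then have "connected_component (- support V E) a b"
        using A B notK by (intro bridge_not_separating[OF E True] connected_component_of_touching_faces[OF E]) auto
      then show ?thesis using faces_eqI[OF A(1) B(1) ab] by simp
    qed
    \<comment> \<open>If no face touches \<open>K\<close>, the chosen set is arbitrary and the
      inclusion trivial.\<close>
    then have "?T \<subseteq> {SOME A. A \<in> ?T}" by (metis (mono_tags, lifting) mem_Collect_eq singleton_iff someI subsetI)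
    then have "finite ?T" "card ?T \<le> card {SOME A. A \<in> ?T}"
      by (rule finite_subset, simp) (rule card_mono[OF _ \<open>?T \<subseteq> _\<close>], simp)
    then show ?thesis by simp
  next
    case False
    obtain c where c: "simple_path c" "pathfinish c = pathstart c" "K \<subseteq> path_image c"
        "path_image c \<subseteq> support V E" "connected (path_image c \<inter> ?D)"
      using closing_curve[OF E False] by blast
    have un: "path_image c \<union> ?D = support V E"
      using c support_remove[OF E(2)] support_mono[of "E - {K}" E V] by auto
    have E': "plane_arcs V (E - {K})" using E plane_arcs_subset by blast
    \<comment> \<open>Janiszewski's theorem for the curve and the rest: \<open>R\<close> joins the
      two points off the curve, and the interior of \<open>K\<close> joins their faces off the
      rest.\<close>
    have eq: "A = B" if A: "A \<in> faces V E" "touches V A K" "a \<in> A"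
        and B: "B \<in> faces V E" "touches V B K" "b \<in> B"
        and R: "connected R" "a \<in> R" "b \<in> R" "R \<inter> path_image c = {}" for A B a b R
    proof -
      have "R \<subseteq> - path_image c" using R by blast
      then have "connected_component (- path_image c) a b"
        using R unfolding connected_component_def by blast
      then have "connected_component (- (path_image c \<union> ?D)) a b"
        using connected_component_of_touching_faces[OF E A B] c E'
        by (intro Janiszewski) (simp_all add: compact_imp_closed compact_support compact_simple_path_image)
      then show ?thesis
        using faces_eqI[OF A(1) B(1) A(3) B(3)] by (simp add: un)
    qed
    note JIO = Jordan_inside_outside[OF c(1,2)]
    have one: "\<exists>A0. {A \<in> ?T. A \<inter> R \<noteq> {}} \<subseteq> {A0}"
      if R: "connected R" "R \<inter> path_image c = {}" for R
    proof (intro exI subsetI)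
      fix A assume A: "A \<in> {A \<in> ?T. A \<inter> R \<noteq> {}}"
      let ?A0 = "SOME A. A \<in> {A \<in> ?T. A \<inter> R \<noteq> {}}"
      have A0: "?A0 \<in> {A \<in> ?T. A \<inter> R \<noteq> {}}" using A by (rule someI)
      obtain a b where "a \<in> A" "a \<in> R" "b \<in> ?A0" "b \<in> R" using A A0 by auto
      then show "A \<in> {?A0}" using eq[of A a ?A0 b R] A A0 R by simp
    qed
    have con1: "connected (inside (path_image c))" and con2: "connected (outside (path_image c))"
      using JIO by simp_all
    obtain A1 where A1: "{A \<in> ?T. A \<inter> inside (path_image c) \<noteq> {}} \<subseteq> {A1}"
      using one[OF con1 inside_no_overlap] by (elim exE)
    obtain A2 where A2: "{A \<in> ?T. A \<inter> outside (path_image c) \<noteq> {}} \<subseteq> {A2}"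
      using one[OF con2 outside_no_overlap] by (elim exE)
    have "?T \<subseteq> {A1, A2}"
    proof
      fix A assume A: "A \<in> ?T"
      then obtain a where "a \<in> A" using ne[of A] by auto
      moreover have "A \<subseteq> - path_image c" using A c(4) in_components_subset[of A "- support V E"]
        by (auto simp: faces_def)
      moreover have "inside (path_image c) \<union> outside (path_image c) = - path_image c" using JIO by simp
      ultimately have "a \<in> inside (path_image c) \<or> a \<in> outside (path_image c)" by blast
      then have "A \<in> {A \<in> ?T. A \<inter> inside (path_image c) \<noteq> {}} \<or> A \<in> {A \<in> ?T. A \<inter> outside (path_image c) \<noteq> {}}"
        using A \<open>a \<in> A\<close> by auto
      then show "A \<in> {A1, A2}" using A1 A2 by blast
    qed
    then have "finite ?T" "card ?T \<le> card {A1, A2}" by (auto intro: finite_subset card_mono)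
    moreover have "card {A1, A2} \<le> 2" by (simp add: card_insert_if)
    ultimately show ?thesis by linarith
  qed
qed

section \<open>The Euler inequality\<close>

lemma bridge_subset:
  assumes "bridge V E K" "F \<subseteq> E"
  shows "bridge V F K"
  using assms support_mono[of "F - {K}" "E - {K}" V] path_component_of_subset
  unfolding bridge_def by (meson Diff_mono order_refl)

lemma acyclic_arcs_subset: "acyclic_arcs V E \<Longrightarrow> F \<subseteq> E \<Longrightarrow> acyclic_arcs V F"
  unfolding acyclic_arcs_def using bridge_subset by blast

lemma connected_Compl_finite: "finite (V :: complex set) \<Longrightarrow> connected (- V)"
  by (simp add: countable_finite path_connected_complement_countable path_connected_imp_connected)

text \<open>Arcs are added one by one to a finite set of points; each is a bridge at that moment and
  so does not separate.\<close>

lemma connected_Compl_acyclic: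
  assumes "plane_arcs V E" "acyclic_arcs V E"
  shows "connected (- support V E)"
proof -
  have "finite E" using assms by (simp add: plane_arcs_def)
  then show ?thesis using assms
  proof (induction E)
    case empty
    then show ?case by (simp add: plane_arcs_def support_def connected_Compl_finite)
  next
    case (insert K F)
    have con: "connected (- support V F)"
      using insert plane_arcs_subset acyclic_arcs_subset by (metis subset_insertI)
    have K: "bridge V (insert K F) K" using insert.prems by (simp add: acyclic_arcs_def)
    have F: "insert K F - {K} = F" using insert.hyps by simp
    have "connected_component (- support V (insert K F)) x y"
      if xy: "x \<in> - support V (insert K F)" "y \<in> - support V (insert K F)" for x y
    proof -
      have "x \<in> - support V F" "y \<in> - support V F" "x \<notin> K" "y \<notin> K"
        using xy by (auto simp: support_def)
      then show ?thesis
        using bridge_not_separating[OF insert.prems(1) _ K, of x y] con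
        by (simp add: F connected_iff_connected_component)
    qed
    then show ?case by (simp add: connected_iff_connected_component)
  qed
qed

text \<open>Off \<open>support V F\<close> the face \<open>A\<close> has no boundary points, so it
  is open and closed in a connected set.\<close>

lemma face_eq_Compl:
  assumes E: "plane_arcs V E" and F: "F \<subseteq> E" and A: "A \<in> faces V E"
    and nt: "\<And>K. K \<in> E - F \<Longrightarrow> \<not> touches V A K" and con: "connected (- support V F)"
  shows "A = - support V F"
proof -
  have A': "A \<in> components (- support V E)" using A by (simp add: faces_def)
  have sub: "A \<subseteq> - support V F"
    using in_components_subset[OF A'] support_mono[OF F, of V] by blast
  have cl: "closure A \<inter> - support V F \<subseteq> A"
  proof
    fix x assume x: "x \<in> closure A \<inter> - support V F"
    have "x \<notin> support V E"
    proof
      assume "x \<in> support V E"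
      then obtain K where "K \<in> E - F" "x \<in> K - V" using x by (auto simp: support_def)
      then show False using nt[of K] x by (auto simp: touches_def)
    qed
    moreover obtain T where "closed T" "A = - support V E \<inter> T"
      using closedin_component[OF A'] by (auto simp: closedin_closed)
    moreover from this have "closure A \<subseteq> T" by (simp add: closure_minimal)
    ultimately show "x \<in> A" using x by blast
  qed
  have "openin (top_of_set (- support V F)) A"
    using open_face[OF E A] sub by (simp add: open_subset)
  moreover have "A = closure A \<inter> - support V F"
    using cl sub closure_subset[of A] by blast
  then have "closedin (top_of_set (- support V F)) A"
    by (metis closed_closure closedin_closed_Int inf_commute)
  ultimately show ?thesis
    using con in_components_nonempty[OF A'] unfolding connected_clopen by blast
qed

text \<open>Every arc touches at most two faces, and a face touched by no arc is the whole
  complement of \<open>V\<close>.\<close>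

lemma finite_faces:
  assumes E: "plane_arcs V E"
  shows "finite (faces V E)"
proof -
  have "faces V E \<subseteq> (\<Union>K\<in>E. {A \<in> faces V E. touches V A K}) \<union> {- support V {}}"
  proof
    fix A assume A: "A \<in> faces V E"
    have "connected (- support V {})"
      using E by (simp add: plane_arcs_def support_def connected_Compl_finite)
    then have "A = - support V {}" if "\<forall>K\<in>E. \<not> touches V A K"
      using face_eq_Compl[OF E _ A, of "{}"] that by simp
    then show "A \<in> (\<Union>K\<in>E. {A \<in> faces V E. touches V A K}) \<union> {- support V {}}"
      using A by blast
  qed
  moreover have "finite (\<Union>K\<in>E. {A \<in> faces V E. touches V A K})"
    using card_touching_faces_le[OF E] E by (intro finite_UN_I) (auto simp: plane_arcs_def)
  ultimately show ?thesis by (meson finite.emptyI finite_UnI finite_insert finite_subset)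
qed

text \<open>The last hypothesis expresses girth at least \<open>g\<close>. Fewer than
  \<open>g\<close> touching arcs would form a forest, whose connected complement would be all of
  \<open>A\<close>; every arc would then belong to this forest.\<close>

lemma card_touched_arcs_ge:
  assumes E: "plane_arcs V E" and A: "A \<in> faces V E" and "\<not> acyclic_arcs V E"
    and g: "\<And>S. S \<subseteq> E \<Longrightarrow> card S < g \<Longrightarrow> acyclic_arcs V S"
  shows "g \<le> card {K \<in> E. touches V A K}"
proof (rule ccontr)
  let ?F = "{K \<in> E. touches V A K}"
  assume "\<not> g \<le> card ?F"
  then have F: "acyclic_arcs V ?F" "plane_arcs V ?F"
    using g[of ?F] E plane_arcs_subset by auto
  have Aeq: "A = - support V ?F"
    by (rule face_eq_Compl[OF E _ A]) (use connected_Compl_acyclic[OF F(2,1)] in auto)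
  have sub: "support V E \<subseteq> support V ?F"
    using Aeq A in_components_subset[of A "- support V E"] by (auto simp: faces_def)
  \<comment> \<open>An interior point of \<open>K\<close> lies on some touching arc, and distinct
    arcs meet only in \<open>V\<close>.\<close>
  have "K \<in> ?F" if K: "K \<in> E" for K
  proof -
    obtain x where x: "x \<in> K - V" using arc_interior_nonempty[OF E K] by blast
    then have "x \<in> support V ?F" using sub K by (auto simp: support_def)
    then obtain L where L: "L \<in> ?F" "x \<in> L" using x by (auto simp: support_def)
    have "K = L"
    proof (rule ccontr)
      assume "K \<noteq> L"
      then have "K \<inter> L \<subseteq> V" using E K L by (simp add: plane_arcs_def)
      then show False using x L by blast
    qed
    then show ?thesis using L by simp
  qed
  then have "?F = E" by blast
  then show False using F assms(3) by simp
qed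

section \<open>Faces and components when one arc is deleted\<close>

lemma face_subset_face_remove:
  assumes A: "A \<in> faces V E"
  obtains B where "B \<in> faces V (E - {K})" "A \<subseteq> B"
proof -
  have A': "A \<in> components (- support V E)" using A by (simp add: faces_def)
  then have "A \<subseteq> - support V (E - {K})"
    using in_components_subset[OF A'] support_mono[of "E - {K}" E V] by blast
  then show thesis
    using exists_component_superset[of A "- support V (E - {K})"] in_components_nonempty[OF A']
      in_components_connected[OF A'] that unfolding faces_def by (metis Compl_empty_eq compl_bot_eq subset_empty)
qed

text \<open>As an arc has empty interior, \<open>B\<close> has a point off \<open>K\<close>, and the
  face through this point stays inside \<open>B\<close>.\<close>

lemma face_remove_superset_face:
  assumes E: "plane_arcs V E" "K \<in> E" and B: "B \<in> faces V (E - {K})"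
  obtains A where "A \<in> faces V E" "A \<subseteq> B"
proof -
  have E': "plane_arcs V (E - {K})" using E plane_arcs_subset by blast
  have B': "B \<in> components (- support V (E - {K}))" using B by (simp add: faces_def)
  obtain g where g: "arc g" "path_image g = K" using E by (metis plane_arcsE)
  have "\<not> B \<subseteq> K"
    using open_not_subset_arc_image[OF g(1) open_face[OF E' B] in_components_nonempty[OF B']] g(2) by simp
  then obtain x where x: "x \<in> B" "x \<notin> K" by blast
  then have "x \<in> - support V E"
    using in_components_subset[OF B'] support_remove[OF E(2), of V] by blast
  then obtain A where A: "A \<in> components (- support V E)" "x \<in> A"
    by (metis UnionE Union_components)
  then have "A \<subseteq> B"
    using components_maximal[OF B' in_components_connected[OF A(1)]] x
      in_components_subset[OF A(1)] support_mono[of "E - {K}" E V] by blast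
  then show thesis using A that by (simp add: faces_def)
qed

lemma faces_remove_unique:
  assumes "B \<in> faces V F" "B' \<in> faces V F" "A \<in> faces V E" "A \<subseteq> B" "A \<subseteq> B'"
  shows "B = B'"
proof -
  have "A \<noteq> {}" using assms(3) in_components_nonempty by (auto simp: faces_def)
  then have "B \<inter> B' \<noteq> {}" using assms by blast
  then show ?thesis using components_nonoverlap assms(1,2) unfolding faces_def by blast
qed

text \<open>A small disc around an interior point of \<open>K\<close> avoids the other arcs and
  meets both sides of the closing curve: without \<open>K\<close> it lies in one face, with
  \<open>K\<close> it meets two.\<close>

lemma cycle_arc_separates_faces:
  assumes E: "plane_arcs V E" "K \<in> E" and "\<not> bridge V E K"
  obtains A1 A2 B where "A1 \<in> faces V E" "A2 \<in> faces V E" "A1 \<noteq> A2"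
    "B \<in> faces V (E - {K})" "A1 \<subseteq> B" "A2 \<subseteq> B"
proof -
  let ?D = "support V (E - {K})"
  obtain c where c: "simple_path c" "pathfinish c = pathstart c" "K \<subseteq> path_image c"
      "path_image c \<subseteq> support V E"
    using closing_curve[OF assms] by metis
  note JIO = Jordan_inside_outside[OF c(1,2)]
  obtain p where p: "p \<in> K - V" using arc_interior_nonempty[OF E] by blast
  have E': "plane_arcs V (E - {K})" using E plane_arcs_subset by blast
  have "open (- ?D)" using compact_support[OF E'] by (simp add: compact_imp_closed open_Compl)
  moreover have "p \<in> - ?D" using p arc_meets_rest[OF E] by blast
  ultimately obtain e where e: "e > 0" "ball p e \<subseteq> - ?D" by (meson open_contains_ball)
  \<comment> \<open>Each side has the whole curve as its frontier and so comes arbitrarily close to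
    \<open>p\<close>.\<close>
  have pick: "\<exists>x\<in>R. x \<in> ball p e" if "frontier R = path_image c" for R
  proof -
    have "p \<in> closure R" using that p c(3) by (auto simp: frontier_def)
    then show ?thesis using e(1) by (metis closure_approachable dist_commute mem_ball)
  qed
  obtain x where x: "x \<in> inside (path_image c)" "x \<in> ball p e"
    using pick[of "inside (path_image c)"] JIO by auto
  obtain y where y: "y \<in> outside (path_image c)" "y \<in> ball p e"
    using pick[of "outside (path_image c)"] JIO by auto
  have notc: "x \<notin> path_image c" "y \<notin> path_image c"
    using x y inside_no_overlap outside_no_overlap by blast+
  then have xy: "x \<in> - support V E" "y \<in> - support V E"
    using x y e(2) c(3) support_remove[OF E(2), of V] by blast+
  obtain A1 where A1: "A1 \<in> components (- support V E)" "x \<in> A1"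
    using xy by (metis UnionE Union_components)
  obtain A2 where A2: "A2 \<in> components (- support V E)" "y \<in> A2"
    using xy by (metis UnionE Union_components)
  obtain B where B: "B \<in> faces V (E - {K})" "A1 \<subseteq> B"
    using face_subset_face_remove A1(1) unfolding faces_def by blast
  have "B \<inter> ball p e \<noteq> {}" using B A1 x by blast
  then have "ball p e \<subseteq> B"
    using components_maximal[of B "- ?D" "ball p e"] B e(2) unfolding faces_def by simp
  then have "B \<inter> A2 \<noteq> {}" using A2 y by blast
  moreover have "A2 \<subseteq> - ?D"
    using in_components_subset[OF A2(1)] support_mono[of "E - {K}" E V] by blast
  ultimately have "A2 \<subseteq> B"
    using components_maximal[of B "- ?D" A2] B in_components_connected[OF A2(1)] unfolding faces_def by simp
  moreover have "A1 \<noteq> A2"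
  proof
    assume "A1 = A2"
    moreover have "A1 \<subseteq> - path_image c"
      using in_components_subset[OF A1(1)] c(4) by blast
    then have "A1 \<subseteq> inside (path_image c) \<union> outside (path_image c)" using JIO by simp
    moreover have "connected A1" by (rule in_components_connected[OF A1(1)])
    moreover have "open (inside (path_image c))" "open (outside (path_image c))"
      "inside (path_image c) \<inter> outside (path_image c) = {}" using JIO by simp_all
    ultimately show False
      using connectedD[of A1 "inside (path_image c)" "outside (path_image c)"] x y A1 A2 by blast
  qed
  ultimately show thesis using that A1 A2 B by (simp add: faces_def)
qed

text \<open>Choosing a smaller face inside each face left after the deletion is injective. If
  \<open>K\<close> is no bridge, some face contains two smaller ones, and one of these is never
  chosen.\<close>

lemma card_faces_remove:
  assumes E: "plane_arcs V E" "K \<in> E"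
  shows "card (faces V (E - {K})) + (if bridge V E K then 0 else 1) \<le> card (faces V E)"
proof -
  have "\<forall>B\<in>faces V (E - {K}). \<exists>A\<in>faces V E. A \<subseteq> B"
    using face_remove_superset_face[OF E] by metis
  then obtain \<psi> where \<psi>: "\<And>B. B \<in> faces V (E - {K}) \<Longrightarrow> \<psi> B \<in> faces V E \<and> \<psi> B \<subseteq> B"
    by metis
  have inj: "inj_on \<psi> (faces V (E - {K}))"
  proof (rule inj_onI)
    fix B B' assume B: "B \<in> faces V (E - {K})" "B' \<in> faces V (E - {K})" "\<psi> B = \<psi> B'"
    then show "B = B'"
      using \<psi>[OF B(1)] \<psi>[OF B(2)] by (intro faces_remove_unique[of B V "E - {K}" B' "\<psi> B" E]) simp_all
  qed
  let ?I = "\<psi> ` faces V (E - {K})"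
  have sub: "?I \<subseteq> faces V E" using \<psi> by blast
  have card: "card ?I = card (faces V (E - {K}))" using inj by (rule card_image)
  show ?thesis
  proof (cases "bridge V E K")
    case True
    then show ?thesis using card card_mono[OF finite_faces[OF E(1)] sub] by simp
  next
    case False
    obtain A1 A2 B where A: "A1 \<in> faces V E" "A2 \<in> faces V E" "A1 \<noteq> A2"
      "B \<in> faces V (E - {K})" "A1 \<subseteq> B" "A2 \<subseteq> B"
      using cycle_arc_separates_faces[OF E False] by metis
    have "A = \<psi> B" if "A \<in> ?I" "A \<subseteq> B" for A
    proof -
      obtain B' where B': "B' \<in> faces V (E - {K})" "A = \<psi> B'" using \<open>A \<in> ?I\<close> by auto
      then have "B' = B"
        using \<psi>[OF B'(1)] A(4) \<open>A \<subseteq> B\<close> by (intro faces_remove_unique[of B' V "E - {K}" B A E]) simp_all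
      then show ?thesis using B' by simp
    qed
    from this[of A1] this[of A2] have "?I \<noteq> faces V E" using A by auto
    then have "card ?I < card (faces V E)"
      using sub finite_faces[OF E(1)] by (simp add: psubset_card_mono psubsetI)
    then show ?thesis using False card by simp
  qed
qed

text \<open>The connected components of the graph, as subsets of the plane.\<close>

definition parts :: "complex set \<Rightarrow> complex set set \<Rightarrow> complex set set" where
  "parts V E = path_component_set (support V E) ` V"

text \<open>Sending each part to the part that absorbs it when \<open>K\<close> is added is onto,
  and it identifies the parts of the two ends of a bridge.\<close>

lemma card_parts_remove:
  assumes E: "plane_arcs V E" "K \<in> E"
  shows "card (parts V E) + (if bridge V E K then 1 else 0) \<le> card (parts V (E - {K}))"
proof -
  let ?D = "support V E" and ?D' = "support V (E - {K})"
  let ?\<Psi> = "\<lambda>X. \<Union>x\<in>X. path_component_set ?D x"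
  have mono: "path_component ?D v x" if "path_component ?D' v x" for v x
    using that support_mono[of "E - {K}" E V] path_component_of_subset by blast
  have \<Psi>: "?\<Psi> (path_component_set ?D' v) = path_component_set ?D v" if "v \<in> V" for v
  proof -
    have "path_component_set ?D x = path_component_set ?D v"
      if "x \<in> path_component_set ?D' v" for x
      using mono that path_component_eq by (metis mem_Collect_eq)
    moreover have "v \<in> path_component_set ?D' v"
      using that by (auto simp: support_def path_component_refl_eq)
    ultimately show ?thesis by blast
  qed
  have img: "parts V E = ?\<Psi> ` parts V (E - {K})"
    unfolding parts_def image_image using \<Psi> by (auto intro!: image_cong)
  have fin: "finite (parts V (E - {K}))" using E by (simp add: parts_def plane_arcs_def)
  show ?thesis
  proof (cases "bridge V E K")
    case False
    then show ?thesis using img fin by (simp add: card_image_le)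
  next
    case True
    then obtain a b where ab: "a \<in> K \<inter> V" "b \<in> K \<inter> V" "\<not> path_component ?D' a b"
      by (auto simp: bridge_def)
    have "path_connected K" using E by (metis arc_imp_path path_connected_path_image plane_arcsE)
    then have "path_component K a b" using ab by (simp add: path_connected_component)
    moreover have "K \<subseteq> ?D" using E by (auto simp: support_def)
    ultimately have "path_component ?D a b" using path_component_of_subset by blast
    then have "?\<Psi> (path_component_set ?D' a) = ?\<Psi> (path_component_set ?D' b)"
      using ab \<Psi> by (metis IntD2 path_component_eq mem_Collect_eq)
    moreover have "path_component_set ?D' a \<noteq> path_component_set ?D' b"
    proof
      assume "path_component_set ?D' a = path_component_set ?D' b"
      moreover have "b \<in> path_component_set ?D' b"
        using ab by (auto simp: support_def path_component_refl_eq)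
      ultimately have "b \<in> path_component_set ?D' a" by simp
      then show False using ab by simp
    qed
    ultimately have "\<not> inj_on ?\<Psi> (parts V (E - {K}))"
      using ab unfolding parts_def inj_on_def by blast
    then have "card (?\<Psi> ` parts V (E - {K})) < card (parts V (E - {K}))"
      using fin by (metis card_image_le inj_on_iff_eq_card le_neq_implies_less)
    then show ?thesis using True img by simp
  qed
qed

text \<open>When an arc is added, a bridge lowers the number of parts and any other arc raises the
  number of faces.\<close>

lemma euler_inequality:
  assumes "plane_arcs V E"
  shows "card E + card (parts V E) + 1 \<le> card V + card (faces V E)"
proof -
  have "finite E" using assms by (simp add: plane_arcs_def)
  then show ?thesis using assms
  proof (induction E)
    case empty
    then have "finite V" by (simp add: plane_arcs_def)
    then have "card (parts V {}) \<le> card V" by (simp add: parts_def card_image_le)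
    moreover have "- support V {} \<noteq> {}"
      using \<open>finite V\<close> infinite_UNIV_char_0[where 'a = complex] ex_new_if_finite
      by (auto simp: support_def)
    then have "faces V {} \<noteq> {}" by (simp add: faces_def components_eq_empty)
    then have "card (faces V {}) \<ge> 1"
      using finite_faces[OF empty] by (simp add: Suc_le_eq card_gt_0_iff)
    ultimately show ?case by simp
  next
    case (insert K F)
    have F: "insert K F - {K} = F" using insert.hyps by simp
    have "plane_arcs V F" using insert.prems plane_arcs_subset by blast
    then show ?case
      using insert.IH insert.hyps card_faces_remove[OF insert.prems, of K]
        card_parts_remove[OF insert.prems, of K] by (auto simp: F split: if_splits)
  qed
qed

text \<open>Unless the graph is a forest, each face is touched by at least \<open>g\<close> arcs and
  each arc touches at most two faces; double counting bounds the faces in the Euler inequality. A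
  forest has one face, and fewer arcs than vertices.\<close>

lemma card_arcs_bound:
  assumes E: "plane_arcs V E" and "V \<noteq> {}" and "2 \<le> g"
    and g: "\<And>S. S \<subseteq> E \<Longrightarrow> card S < g \<Longrightarrow> acyclic_arcs V S"
  shows "(g - 2) * card E < g * card V"
proof (cases "acyclic_arcs V E")
  case True
  have "finite V" using E by (simp add: plane_arcs_def)
  then have "card (parts V E) \<ge> 1"
    using \<open>V \<noteq> {}\<close> by (simp add: parts_def Suc_le_eq card_gt_0_iff)
  moreover have "faces V E \<subseteq> {- support V E}"
    using connected_Compl_acyclic[OF E True] in_components_maximal
    by (metis components_eq_sing_iff components_empty empty_subsetI faces_def subset_refl)
  then have "card (faces V E) \<le> 1" using card_mono[of "{- support V E}"] by fastforce
  ultimately have "card E < card V" using euler_inequality[OF E] by linarith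
  then have "g * card E < g * card V" using \<open>2 \<le> g\<close> by simp
  then show ?thesis by (meson diff_le_self le_less_trans mult_le_mono1)
next
  case False
  have fin: "finite E" "finite (faces V E)" using E finite_faces[OF E] by (auto simp: plane_arcs_def)
  have "g * card (faces V E) \<le> (\<Sum>A\<in>faces V E. card {K \<in> E. touches V A K})"
    using sum_bounded_below[of "faces V E" g "\<lambda>A. card {K \<in> E. touches V A K}"]
      card_touched_arcs_ge[OF E _ False g] by (simp add: mult.commute)
  also have "\<dots> = (\<Sum>K\<in>E. card {A \<in> faces V E. touches V A K})"
    using fin by (intro sum_multicount_gen) auto
  also have "\<dots> \<le> 2 * card E"
    using sum_bounded_above[of E "\<lambda>K. card {A \<in> faces V E. touches V A K}" 2]
      card_touching_faces_le[OF E] by (simp add: mult.commute)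
  finally have "g * card (faces V E) \<le> 2 * card E" .
  \<comment> \<open>The summand 1 of the Euler inequality makes the final bound strict.\<close>
  moreover have "g * (card E + 1) \<le> g * (card V + card (faces V E))"
    using euler_inequality[OF E] by (intro mult_le_mono2) linarith
  ultimately have "g * card E + g \<le> g * card V + 2 * card E"
    by (simp add: algebra_simps)
  moreover have "2 * card E \<le> g * card E" using \<open>2 \<le> g\<close> by simp
  ultimately have "g * card E - 2 * card E < g * card V" using \<open>2 \<le> g\<close> by linarith
  then show ?thesis by (simp add: diff_mult_distrib)
qed

section \<open>Edge bounds for planar graphs\<close>

text \<open>The reachable vertices with their arcs, and the remaining vertices and arcs, form two
  disjoint closed sets covering the support. A path from \<open>a\<close> is connected and cannot
  leave the first.\<close>

lemma path_component_arcs_chain: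
  assumes S: "plane_arcs V S" and "a \<in> V" "b \<in> V" and ab: "path_component (support V S) a b"
  shows "(a, b) \<in> {(x, y). \<exists>K\<in>S. K \<inter> V = {x, y}}\<^sup>*"
proof -
  define T where "T = {(x, y). \<exists>K\<in>S. K \<inter> V = {x, y}}"
  define R where "R = {z \<in> V. (a, z) \<in> T\<^sup>*}"
  have step: "z \<in> R" if K: "K \<in> S" "r \<in> K" "r \<in> R" "z \<in> K" "z \<in> V" for K r z
  proof (cases "r = z")
    case False
    obtain g where "K \<inter> V = {pathstart g, pathfinish g}" using S K(1) by (metis plane_arcsE)
    moreover have "{r, z} \<subseteq> K \<inter> V" using K by (auto simp: R_def)
    ultimately have "K \<inter> V = {r, z}" using False by auto
    then have "(r, z) \<in> T" using K by (auto simp: T_def)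
    then show ?thesis using K by (auto simp: R_def)
  qed (use K in simp)
  define X where "X = R \<union> \<Union>{K \<in> S. K \<inter> R \<noteq> {}}"
  define Y where "Y = (V - R) \<union> \<Union>{K \<in> S. K \<inter> R = {}}"
  have fin: "finite V" "finite S" using S by (auto simp: plane_arcs_def)
  have clK: "closed K" if "K \<in> S" for K
    using S that by (metis closed_arc_image plane_arcsE)
  have cl: "closed X" "closed Y"
    unfolding X_def Y_def using fin clK finite_imp_closed[of R] finite_imp_closed[of "V - R"]
    by (auto intro!: closed_Un closed_Union simp: R_def)
  have inX: "z \<in> R" if "z \<in> X" "z \<in> V" for z
    using that step by (auto simp: X_def)
  have XY: "X \<inter> Y = {}"
  proof (rule ccontr)
    assume "X \<inter> Y \<noteq> {}"
    then obtain z where z: "z \<in> X" "z \<in> Y" by blast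
    show False
    proof (cases "z \<in> V")
      case True
      then show False using inX z by (auto simp: Y_def)
    next
      case False
      then obtain K L where KL: "K \<in> S" "K \<inter> R \<noteq> {}" "z \<in> K" "L \<in> S" "L \<inter> R = {}" "z \<in> L"
        using z by (auto simp: X_def Y_def R_def)
      then have "K \<inter> L \<subseteq> V" using S unfolding plane_arcs_def by metis
      then show False using KL False by blast
    qed
  qed
  have sup: "support V S = X \<union> Y"
    by (auto simp: support_def X_def Y_def R_def)
  obtain p where p: "path p" "path_image p \<subseteq> X \<union> Y" "pathstart p = a" "pathfinish p = b"
    using ab unfolding path_component_def sup by blast
  have "a \<in> X" using \<open>a \<in> V\<close> by (simp add: X_def R_def)
  have "b \<notin> Y"
  proof
    assume "b \<in> Y"
    moreover have "a \<in> path_image p" "b \<in> path_image p"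
      using p by (metis pathstart_in_path_image, metis pathfinish_in_path_image)
    ultimately show False
      using connected_path_image[OF p(1)] p(2) cl XY \<open>a \<in> X\<close> unfolding connected_closed by blast
  qed
  then have "b \<in> R" using \<open>b \<in> V\<close> by (auto simp: Y_def)
  then show ?thesis by (simp add: R_def T_def)
qed

lemma rtrancl_distinct_path:
  assumes "(u, v) \<in> r\<^sup>*"
  obtains p where "p \<noteq> []" "hd p = u" "last p = v" "distinct p" "successively (\<lambda>x y. (x, y) \<in> r) p"
proof -
  have "\<exists>p. p \<noteq> [] \<and> hd p = u \<and> last p = v \<and> distinct p \<and> successively (\<lambda>x y. (x, y) \<in> r) p"
    using assms
  proof (induction rule: converse_rtrancl_induct)
    case base
    show ?case by (rule exI[of _ "[v]"]) simp
  next
    case (step u w)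
    then obtain p where p: "p \<noteq> []" "hd p = w" "last p = v" "distinct p"
        "successively (\<lambda>x y. (x, y) \<in> r) p" by blast
    show ?case
    proof (cases "u \<in> set p")
      case True
      then obtain ys zs where "p = ys @ u # zs" by (meson split_list)
      then show ?thesis using p by (intro exI[of _ "u # zs"]) (auto simp: successively_append_iff)
    next
      case False
      then show ?thesis using p step.hyps by (intro exI[of _ "u # p"]) (auto simp: successively_Cons)
    qed
  qed
  then show thesis using that by blast
qed

lemma pair_graphD:
  assumes "pair_graph G"
  shows "finite (pverts G)" "finite (parcs G)" "sym (parcs G)" "parcs G \<subseteq> pverts G \<times> pverts G"
    "(u, v) \<in> parcs G \<Longrightarrow> u \<noteq> v"
proof -
  interpret pair_graph G by (rule assms)
  show "finite (pverts G)" "finite (parcs G)" by auto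
  show "sym (parcs G)" using sym_arcs by (simp add: symmetric_def)
  show "parcs G \<subseteq> pverts G \<times> pverts G" using in_arcsD1 in_arcsD2 by auto
  show "u \<noteq> v" if "(u, v) \<in> parcs G" using no_loops[OF that] by simp
qed

text \<open>The factor 2 is there because \<open>F\<close> holds both directions of each edge.
  Applied with \<open>g\<close> equal to 3, 4 and 6.\<close>

lemma planar_edge_bound:
  assumes G: "pair_graph G" "planar G"
    and U: "U \<subseteq> pverts G" "U \<noteq> {}"
    and F: "F \<subseteq> parcs G" "F \<subseteq> U \<times> U" "sym F" and "2 \<le> g"
    and girth: "\<And>p. \<lbrakk>distinct p; 3 \<le> length p; successively (\<lambda>a b. (a, b) \<in> F) p;
                  (last p, hd p) \<in> F\<rbrakk> \<Longrightarrow> g \<le> length p"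
  shows "(g - 2) * card F < 2 * g * card U"
proof -
  obtain pos \<gamma> where dr: "plane_drawing G pos \<gamma>" using G(2) by (auto simp: planar_def)
  define \<kappa> where "\<kappa> e = path_image (\<gamma> e)" for e
  define V where "V = pos ` U"
  define E where "E = \<kappa> ` F"
  have inj: "inj_on pos U" using dr U(1) unfolding plane_drawing_def by (meson inj_on_subset)
  have dr1: "arc (\<gamma> (u, v))" "pathstart (\<gamma> (u, v)) = pos u" "pathfinish (\<gamma> (u, v)) = pos v"
      "\<gamma> (v, u) = reversepath (\<gamma> (u, v))" "\<gamma> (u, v) ` {0<..<1} \<inter> pos ` pverts G = {}"
    if "(u, v) \<in> F" for u v
  proof -
    have uv: "(u, v) \<in> parcs G" using F(1) that by blast
    have "\<forall>(u, v)\<in>parcs G. arc (\<gamma> (u, v)) \<and> pathstart (\<gamma> (u, v)) = pos u \<and>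
        pathfinish (\<gamma> (u, v)) = pos v \<and> \<gamma> (v, u) = reversepath (\<gamma> (u, v)) \<and>
        \<gamma> (u, v) ` {0<..<1} \<inter> pos ` pverts G = {}"
      using dr unfolding plane_drawing_def by (elim conjE)
    from bspec[OF this uv] show "arc (\<gamma> (u, v))" "pathstart (\<gamma> (u, v)) = pos u" "pathfinish (\<gamma> (u, v)) = pos v"
      "\<gamma> (v, u) = reversepath (\<gamma> (u, v))" "\<gamma> (u, v) ` {0<..<1} \<inter> pos ` pverts G = {}"
      by simp_all
  qed
  have dr2: "\<gamma> (u, v) ` {0<..<1} \<inter> \<kappa> (x, y) = {}"
    if "(u, v) \<in> F" "(x, y) \<in> F" "{u, v} \<noteq> {x, y}" for u v x y
  proof -
    have "\<forall>(u, v)\<in>parcs G. \<forall>(x, y)\<in>parcs G. {u, v} \<noteq> {x, y} \<longrightarrow>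
        \<gamma> (u, v) ` {0<..<1} \<inter> path_image (\<gamma> (x, y)) = {}"
      using dr unfolding plane_drawing_def by (elim conjE)
    moreover have "(u, v) \<in> parcs G" "(x, y) \<in> parcs G" using that F(1) by blast+
    ultimately show ?thesis using that(3) unfolding \<kappa>_def by fast
  qed
  have img: "\<kappa> (u, v) = \<gamma> (u, v) ` {0<..<1} \<union> {pos u, pos v}" if "(u, v) \<in> F" for u v
  proof -
    have "{0..1::real} = {0<..<1} \<union> {0, 1}" by auto
    then show ?thesis
      using dr1(2,3)[OF that] by (simp add: \<kappa>_def path_image_def pathstart_def pathfinish_def insert_commute)
  qed
  have ends: "\<kappa> (u, v) \<inter> V = {pos u, pos v}" if "(u, v) \<in> F" for u v
    using img[OF that] dr1(5)[OF that] U(1) F(2) that unfolding V_def by blast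
  have ends_eq: "{u, v} = {x, y}" if "(u, v) \<in> F" "(x, y) \<in> F" "\<kappa> (u, v) = \<kappa> (x, y)" for u v x y
  proof (rule ccontr)
    assume "{u, v} \<noteq> {x, y}"
    then have "\<gamma> (u, v) ` {0<..<1} \<inter> \<kappa> (u, v) = {}" using dr2[OF that(1,2)] that(3) by simp
    then show False using img[OF that(1)] dense[of 0 "1::real"] by auto
  qed
  have rev: "\<kappa> (v, u) = \<kappa> (u, v)" if "(u, v) \<in> F" for u v
    using dr1(4)[OF that] by (simp add: \<kappa>_def)
  have finF: "finite F" using F(1) pair_graphD(2)[OF G(1)] finite_subset by blast
  have finU: "finite U" using U(1) pair_graphD(1)[OF G(1)] finite_subset by blast
  have neq: "u \<noteq> v" if "(u, v) \<in> F" for u v using that F(1) pair_graphD(5)[OF G(1)] by blast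
  have PA: "plane_arcs V E"
    unfolding plane_arcs_def
  proof (intro conjI ballI impI)
    show "finite V" "finite E" using finU finF by (auto simp: V_def E_def)
  next
    fix K assume "K \<in> E"
    then obtain u v where uv: "(u, v) \<in> F" "K = \<kappa> (u, v)" by (auto simp: E_def)
    then show "\<exists>g. arc g \<and> path_image g = K \<and> K \<inter> V = {pathstart g, pathfinish g}"
      using dr1(1,2,3)[OF uv(1)] ends[OF uv(1)] by (intro exI[of _ "\<gamma> (u, v)"]) (simp add: \<kappa>_def)
  next
    fix K L assume "K \<in> E" "L \<in> E" and KL: "K \<noteq> L"
    then obtain u v x y where uv: "(u, v) \<in> F" "K = \<kappa> (u, v)" and xy: "(x, y) \<in> F" "L = \<kappa> (x, y)"
      by (auto simp: E_def)
    have "{u, v} \<noteq> {x, y}" using KL uv xy rev[OF xy(1)] by (auto simp: doubleton_eq_iff)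
    then have "\<gamma> (u, v) ` {0<..<1} \<inter> L = {}" using dr2[OF uv(1) xy(1)] xy by simp
    then show "K \<inter> L \<subseteq> V" using img[OF uv(1)] uv F(2) by (auto simp: V_def)
  qed
  have "card F \<le> 2 * card E"
  proof -
    have "F = (\<Union>K\<in>E. {e \<in> F. \<kappa> e = K})" by (auto simp: E_def)
    then have "card F \<le> (\<Sum>K\<in>E. card {e \<in> F. \<kappa> e = K})"
      using card_UN_le[of E "\<lambda>K. {e \<in> F. \<kappa> e = K}"] finF by (simp add: E_def)
    also have "\<dots> \<le> (\<Sum>K\<in>E. 2)"
    proof (rule sum_mono)
      fix K assume "K \<in> E"
      then obtain u v where uv: "(u, v) \<in> F" "K = \<kappa> (u, v)" by (auto simp: E_def)
      have "{e \<in> F. \<kappa> e = K} \<subseteq> {(u, v), (v, u)}"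
        using ends_eq[OF _ uv(1)] uv(2) by (auto simp: doubleton_eq_iff)
      then have "card {e \<in> F. \<kappa> e = K} \<le> card {(u, v), (v, u)}" by (intro card_mono) auto
      then show "card {e \<in> F. \<kappa> e = K} \<le> 2" by (simp add: card_insert_if split: if_splits)
    qed
    finally show ?thesis by simp
  qed
  moreover have "(g - 2) * card E < g * card V"
  proof (rule card_arcs_bound[OF PA _ \<open>2 \<le> g\<close>])
    show "V \<noteq> {}" using U by (simp add: V_def)
  next
    fix S assume S: "S \<subseteq> E" "card S < g"
    show "acyclic_arcs V S"
      unfolding acyclic_arcs_def
    proof (rule ballI, rule ccontr)
      \<comment> \<open>If \<open>K\<close> were no bridge, its ends would be joined through other
        arcs of \<open>S\<close>, and adding \<open>K\<close> would give a cycle with at most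
        \<open>card S\<close> edges, below the girth.\<close>
      fix K assume K: "K \<in> S" "\<not> bridge V S K"
      obtain u v where uv: "(u, v) \<in> F" "K = \<kappa> (u, v)" using K S by (auto simp: E_def)
      define r where "r = {(x, y) \<in> F. \<kappa> (x, y) \<in> S - {K}}"
      have uvU: "u \<in> U" "v \<in> U" using uv F(2) by auto
      have pc: "path_component (support V (S - {K})) (pos u) (pos v)"
        using K(2) ends[OF uv(1)] uv(2) by (simp add: bridge_def)
      have "plane_arcs V (S - {K})" using PA S plane_arcs_subset by (meson Diff_subset subset_trans)
      then have ch: "(pos u, pos v) \<in> {(x, y). \<exists>L\<in>S - {K}. L \<inter> V = {x, y}}\<^sup>*"
        using path_component_arcs_chain[OF _ _ _ pc] uvU by (simp add: V_def)
      \<comment> \<open>The chain of points is lifted to a walk in \<open>F\<close>; injectivity of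
        \<open>pos\<close> makes consecutive edges fit.\<close>
      have "\<exists>w\<in>U. z = pos w \<and> (u, w) \<in> r\<^sup>*"
        if "(pos u, z) \<in> {(x, y). \<exists>L\<in>S - {K}. L \<inter> V = {x, y}}\<^sup>*" for z
        using that
      proof (induction rule: rtrancl_induct)
        case base
        then show ?case using uvU by blast
      next
        case (step y z)
        then obtain w L where w: "w \<in> U" "y = pos w" "(u, w) \<in> r\<^sup>*" and L: "L \<in> S - {K}" "L \<inter> V = {y, z}"
          by auto
        have "L \<in> E" using L S by blast
        then obtain x1 x2 where x: "(x1, x2) \<in> F" "L = \<kappa> (x1, x2)" by (auto simp: E_def)
        have x': "(x2, x1) \<in> F" using x F(3) by (meson symD)
        have xU: "x1 \<in> U" "x2 \<in> U" using x F(2) by auto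
        have "{pos w, z} = {pos x1, pos x2}" using ends[OF x(1)] L x w by simp
        then consider "pos w = pos x1" "z = pos x2" | "pos w = pos x2" "z = pos x1"
          by (auto simp: doubleton_eq_iff)
        then show ?case
        proof cases
          case 1
          then have "w = x1" using inj w xU by (meson inj_onD)
          then have "(w, x2) \<in> r" using x L by (simp add: r_def)
          with w(3) have "(u, x2) \<in> r\<^sup>*" by (rule rtrancl_into_rtrancl)
          then show ?thesis using 1 xU by blast
        next
          case 2
          then have "w = x2" using inj w xU by (meson inj_onD)
          then have "(w, x1) \<in> r" using x x' L rev[OF x(1)] by (simp add: r_def)
          with w(3) have "(u, x1) \<in> r\<^sup>*" by (rule rtrancl_into_rtrancl)
          then show ?thesis using 2 xU by blast
        qed
      qed
      from this[OF ch] obtain w where w: "w \<in> U" "pos v = pos w" "(u, w) \<in> r\<^sup>*" by blast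
      then have "(u, v) \<in> r\<^sup>*" using inj_onD[OF inj w(2) uvU(2) w(1)] by simp
      then obtain p where p: "p \<noteq> []" "hd p = u" "last p = v" "distinct p"
        "successively (\<lambda>x y. (x, y) \<in> r) p" by (rule rtrancl_distinct_path)
      have nth: "(p ! i, p ! Suc i) \<in> r" if "Suc i < length p" for i
        using p(5) that by (simp add: successively_conv_nth)
      \<comment> \<open>A path on one vertex would make the edge a loop, and a path on two vertices
        would use \<open>K\<close> itself.\<close>
      have len: "3 \<le> length p"
      proof (rule ccontr)
        assume "\<not> 3 \<le> length p"
        moreover have "length p \<noteq> 0" using p(1) by simp
        ultimately have "length p = 1 \<or> length p = 2" by linarith
        then consider "length p = 1" | "length p = 2" by blast
        then show False
        proof cases
          case 1
          then have "u = v" using p(2,3) by (cases p) auto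
          then show False using neq uv by blast
        next
          case 2
          then have "p ! 0 = u" "p ! 1 = v" using p(1-3) by (auto simp: hd_conv_nth last_conv_nth)
          then have "(u, v) \<in> r" using nth[of 0] 2 by simp
          then show False using uv by (simp add: r_def)
        qed
      qed
      have "successively (\<lambda>a b. (a, b) \<in> F) p"
        using p(5) by (rule successively_mono) (auto simp: r_def)
      then have "g \<le> length p"
        using girth[OF p(4) len] uv F(3) p(2,3) by (metis symD)
      moreover have "length p - 1 \<le> card (S - {K})"
      proof -
        let ?f = "\<lambda>i. \<kappa> (p ! i, p ! Suc i)"
        \<comment> \<open>Consecutive pairs of a list without repetitions are distinct
          edges.\<close>
        have "inj_on ?f {..<length p - 1}"
        proof (rule inj_onI)
          fix i j assume ij: "i \<in> {..<length p - 1}" "j \<in> {..<length p - 1}" "?f i = ?f j"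
          then have "{p ! i, p ! Suc i} = {p ! j, p ! Suc j}"
            using nth by (intro ends_eq) (auto simp: r_def)
          then show "i = j"
            using ij p(4) by (auto simp: doubleton_eq_iff nth_eq_iff_index_eq)
        qed
        moreover have "?f ` {..<length p - 1} \<subseteq> S - {K}"
        proof (rule image_subsetI)
          fix i assume "i \<in> {..<length p - 1}"
          then have "Suc i < length p" by auto
          from nth[OF this] show "?f i \<in> S - {K}" by (simp add: r_def)
        qed
        moreover have "finite (S - {K})"
          using S finF by (auto simp: E_def intro: finite_subset)
        ultimately show ?thesis using card_inj_on_le by fastforce
      qed
      moreover have "finite S" using S finF by (auto simp: E_def intro: finite_subset)
      then have "card (S - {K}) = card S - 1" "card S \<ge> 1"
        using K by (auto simp: Suc_le_eq card_gt_0_iff)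
      ultimately show False using S(2) len by linarith
    qed
  qed
  moreover have "card V = card U" using inj by (simp add: V_def card_image)
  ultimately have "(g - 2) * card F \<le> (g - 2) * (2 * card E)" "(g - 2) * card E < g * card U"
    by (auto intro: mult_le_mono2)
  then show ?thesis by linarith
qed

section \<open>Labellings by vectors over the field with two elements\<close>

text \<open>A set of indices stands for the vector with ones at these positions. This is the sum
  over \<open>J\<close> modulo 2; the parity of \<open>card (x \<inter> y)\<close> is the scalar
  product.\<close>

definition vsum :: "('a \<Rightarrow> nat set) \<Rightarrow> 'a set \<Rightarrow> nat set" where
  "vsum f J = {i. odd (card {j \<in> J. i \<in> f j})}"

text \<open>Linear independence of the family: over two elements, linear combinations are sums over
  subsets.\<close>

definition indep :: "('a \<Rightarrow> nat set) \<Rightarrow> 'a set \<Rightarrow> bool" where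
  "indep f N \<longleftrightarrow> (\<forall>J\<subseteq>N. J \<noteq> {} \<longrightarrow> vsum f J \<noteq> {})"

lemma prod_one_plus:
  fixes h :: "'b \<Rightarrow> int"
  assumes "finite A"
  shows "(\<Prod>x\<in>A. 1 + h x) = (\<Sum>B\<in>Pow A. \<Prod>x\<in>B. h x)"
  using assms
proof (induction A)
  case (insert a A)
  have *: "(\<Sum>B\<in>insert a ` Pow A. \<Prod>x\<in>B. h x) = (\<Sum>B\<in>Pow A. h a * (\<Prod>x\<in>B. h x))"
  proof (subst sum.reindex)
    show "inj_on (insert a) (Pow A)" using insert.hyps by (auto simp: inj_on_def)
    have "a \<notin> B" "finite B" if "B \<in> Pow A" for B
      using that insert.hyps by (auto intro: finite_subset)
    then show "sum ((\<lambda>B. \<Prod>x\<in>B. h x) \<circ> insert a) (Pow A) = (\<Sum>B\<in>Pow A. h a * (\<Prod>x\<in>B. h x))"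
      by (intro sum.cong) auto
  qed
  have "Pow A \<inter> insert a ` Pow A = {}" using insert.hyps by auto
  then have "(\<Sum>B\<in>Pow (insert a A). \<Prod>x\<in>B. h x) =
      (\<Sum>B\<in>Pow A. \<Prod>x\<in>B. h x) + (\<Sum>B\<in>insert a ` Pow A. \<Prod>x\<in>B. h x)"
    using insert.hyps by (simp add: Pow_insert sum.union_disjoint)
  then show ?case
    using insert by (simp add: * sum_distrib_left[symmetric] algebra_simps)
qed simp

text \<open>Expanding the indicator of each equation as \<open>(1 \<plusminus> (-1)^k) / 2\<close>, independence leaves only the
  term of the empty set of equations.\<close>

lemma card_solutions:
  fixes f :: "'a \<Rightarrow> nat set"
  assumes N: "finite N" and T: "finite T" and f: "\<And>v. v \<in> N \<Longrightarrow> f v \<subseteq> T" and "indep f N"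
  shows "card {x \<in> Pow T. \<forall>v\<in>N. odd (card (x \<inter> f v)) \<longleftrightarrow> \<pi> v} * 2 ^ card N = 2 ^ card T"
proof -
  let ?S = "{x \<in> Pow T. \<forall>v\<in>N. odd (card (x \<inter> f v)) \<longleftrightarrow> \<pi> v}"
  \<comment> \<open>\<open>t\<close> is the prescribed sign and \<open>s\<close> the actual one, so
    \<open>1 + t v * s v x\<close> is twice the indicator of the equation at \<open>v\<close>.
    \<open>e J i\<close> is the sign of entry \<open>i\<close> of \<open>vsum f J\<close>.\<close>
  define t :: "'a \<Rightarrow> int" where "t v = (if \<pi> v then - 1 else 1)" for v
  define s :: "'a \<Rightarrow> nat set \<Rightarrow> int" where "s v x = (- 1) ^ card (x \<inter> f v)" for v x
  define e :: "'a set \<Rightarrow> nat \<Rightarrow> int" where "e J i = (- 1) ^ card {j \<in> J. i \<in> f j}" for J i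
  have s: "(\<Prod>v\<in>J. s v x) = (\<Prod>i\<in>x. e J i)" if "J \<subseteq> N" "x \<subseteq> T" for J x
  proof -
    have fin: "finite J" "finite x" using that N T finite_subset by blast+
    have *: "(\<Prod>i\<in>A. if P i then - 1 else (1::int)) = (- 1) ^ card {i \<in> A. P i}"
      if "finite A" for A :: "'c set" and P
      using that by (simp add: prod.If_cases Int_def)
    have "s v x = (\<Prod>i\<in>x. if i \<in> f v then - 1 else 1)" for v
      using *[OF fin(2), of "\<lambda>i. i \<in> f v"] by (simp add: s_def Int_def)
    then have "(\<Prod>v\<in>J. s v x) = (\<Prod>v\<in>J. \<Prod>i\<in>x. if i \<in> f v then - 1 else 1)" by simp
    also have "\<dots> = (\<Prod>i\<in>x. \<Prod>v\<in>J. if i \<in> f v then - 1 else 1)" by (rule prod.swap)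
    also have "\<dots> = (\<Prod>i\<in>x. e J i)"
      using *[OF fin(1)] by (simp add: e_def)
    finally show ?thesis .
  qed
  \<comment> \<open>The sum over all \<open>x\<close> factorises over the coordinates, and a
    coordinate in \<open>vsum f J\<close> contributes the factor 0.\<close>
  have inner: "(\<Sum>x\<in>Pow T. \<Prod>v\<in>J. s v x) = (if J = {} then 2 ^ card T else 0)" if "J \<subseteq> N" for J
  proof -
    have "(\<Sum>x\<in>Pow T. \<Prod>v\<in>J. s v x) = (\<Sum>x\<in>Pow T. \<Prod>i\<in>x. e J i)"
      using s[OF that] by (intro sum.cong) auto
    also have "\<dots> = (\<Prod>i\<in>T. 1 + e J i)" using prod_one_plus[OF T] by simp
    also have "\<dots> = (if J = {} then 2 ^ card T else 0)"
    proof (cases "J = {}")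
      case False
      then have "vsum f J \<noteq> {}" using \<open>indep f N\<close> that by (simp add: indep_def)
      then obtain i where i: "odd (card {j \<in> J. i \<in> f j})" by (auto simp: vsum_def)
      then have "{j \<in> J. i \<in> f j} \<noteq> {}" by fastforce
      then have "i \<in> T" using f that by blast
      moreover have "1 + e J i = 0" using i by (simp add: e_def)
      ultimately show ?thesis using False prod_zero[OF T, of "\<lambda>i. 1 + e J i"] by auto
    qed (simp add: e_def)
    finally show ?thesis .
  qed
  have "(\<Sum>x\<in>Pow T. \<Prod>v\<in>N. 1 + t v * s v x) = (\<Sum>x\<in>Pow T. if x \<in> ?S then 2 ^ card N else 0)"
  proof (rule sum.cong[OF refl])
    fix x assume x: "x \<in> Pow T"
    have val: "1 + t v * s v x = (if odd (card (x \<inter> f v)) \<longleftrightarrow> \<pi> v then 2 else 0)" for v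
      by (auto simp: t_def s_def)
    show "(\<Prod>v\<in>N. 1 + t v * s v x) = (if x \<in> ?S then 2 ^ card N else 0)"
    proof (cases "x \<in> ?S")
      case True
      then show ?thesis by (simp add: val)
    next
      case False
      then show ?thesis using x N by (auto simp: val intro!: prod_zero)
    qed
  qed
  also have "\<dots> = 2 ^ card N * int (card ?S)"
  proof -
    have "(\<Sum>x\<in>Pow T. if x \<in> ?S then 2 ^ card N else 0) = (\<Sum>x\<in>?S. (2::int) ^ card N)"
      using T by (intro sum.mono_neutral_cong_right) auto
    then show ?thesis by simp
  qed
  finally have "2 ^ card N * int (card ?S) = (\<Sum>x\<in>Pow T. \<Prod>v\<in>N. 1 + t v * s v x)" ..
  also have "\<dots> = (\<Sum>x\<in>Pow T. \<Sum>J\<in>Pow N. (\<Prod>v\<in>J. t v) * (\<Prod>v\<in>J. s v x))"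
    by (simp add: prod_one_plus[OF N] prod.distrib)
  also have "\<dots> = (\<Sum>J\<in>Pow N. (\<Prod>v\<in>J. t v) * (\<Sum>x\<in>Pow T. \<Prod>v\<in>J. s v x))"
    by (subst sum.swap) (simp add: sum_distrib_left)
  also have "\<dots> = (\<Sum>J\<in>Pow N. if J = {} then 2 ^ card T else 0)"
    using inner by (intro sum.cong) auto
  also have "\<dots> = 2 ^ card T" using N by (simp add: sum.delta')
  finally have "int (card ?S * 2 ^ card N) = int (2 ^ card T)" by (simp add: mult.commute)
  then show ?thesis by (simp only: of_nat_eq_iff)
qed

section \<open>The greedy choice of the vectors\<close>

definition nb :: "('a \<times> 'a) set \<Rightarrow> 'a set \<Rightarrow> 'a \<Rightarrow> 'a set" where
  "nb E U w = {v \<in> U. (w, v) \<in> E}"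

text \<open>The sets \<open>J\<close> for which the vector of \<open>u\<close> must differ from \<open>vsum f J\<close>, so that the
  neighbourhoods in \<open>U\<close> of the vertices outside \<open>U\<close> stay independent.\<close>

definition forbidden :: "('a \<times> 'a) set \<Rightarrow> 'a set \<Rightarrow> 'a set \<Rightarrow> 'a \<Rightarrow> 'a set set" where
  "forbidden E V U u = (\<Union>w\<in>{w \<in> V - U. (w, u) \<in> E}. Pow (nb E U w - {u}))"

lemma vsum_cong: "(\<And>j. j \<in> J \<Longrightarrow> f j = g j) \<Longrightarrow> vsum f J = vsum g J"
  unfolding vsum_def by (metis (no_types, lifting) Collect_cong)

lemma vsum_update:
  assumes "finite J" "u \<in> J"
  shows "vsum (f(u := x)) J = {i. i \<in> x \<longleftrightarrow> i \<notin> vsum f (J - {u})}"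
proof -
  have "odd (card {j \<in> J. i \<in> (f(u := x)) j}) \<longleftrightarrow> (i \<in> x \<longleftrightarrow> even (card {j \<in> J - {u}. i \<in> f j}))" for i
  proof -
    have "{j \<in> J. i \<in> (f(u := x)) j} = (if i \<in> x then insert u else id) {j \<in> J - {u}. i \<in> f j}"
      using assms by auto
    then show ?thesis using assms by auto
  qed
  then show ?thesis by (simp add: vsum_def)
qed

text \<open>Induction on the set \<open>U\<close> of labelled vertices: the vertex given by
  \<open>sel\<close> is labelled last, after \<open>U - {u}\<close>. The bound \<open>k\<close> on
  the neighbours of outside vertices is carried along because \<open>sel\<close> requires
  it.\<close>

lemma exists_vector_labelling:
  fixes E :: "('a \<times> 'a) set" and \<pi> :: "'a \<Rightarrow> 'a \<Rightarrow> bool"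
  assumes V: "finite V" and E: "sym E" "irrefl E" and "k \<le> t"
    and sel: "\<And>U. \<lbrakk>U \<subseteq> V; U \<noteq> {}; \<forall>w\<in>V - U. card (nb E U w) \<le> k\<rbrakk> \<Longrightarrow>
        \<exists>u\<in>U. card (nb E U u) \<le> k \<and> card (forbidden E V U u) < 2 ^ (t - card (nb E U u))"
    and \<pi>: "\<And>u v. (u, v) \<in> E \<Longrightarrow> \<pi> u v = \<pi> v u"
  obtains f :: "'a \<Rightarrow> nat set" where "\<And>v. v \<in> V \<Longrightarrow> f v \<subseteq> {..<t}"
    "\<And>u v. \<lbrakk>u \<in> V; v \<in> V; (u, v) \<in> E\<rbrakk> \<Longrightarrow> odd (card (f u \<inter> f v)) \<longleftrightarrow> \<pi> u v"
proof -
  have "\<exists>f :: 'a \<Rightarrow> nat set. (\<forall>v\<in>U. f v \<subseteq> {..<t}) \<and>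
      (\<forall>u\<in>U. \<forall>v\<in>U. (u, v) \<in> E \<longrightarrow> (odd (card (f u \<inter> f v)) \<longleftrightarrow> \<pi> u v)) \<and>
      (\<forall>w\<in>V - U. indep f (nb E U w))"
    if "U \<subseteq> V" "\<forall>w\<in>V - U. card (nb E U w) \<le> k" for U
    using finite_subset[OF \<open>U \<subseteq> V\<close> V] that
  proof (induction U rule: finite_psubset_induct)
    case (psubset U)
    show ?case
    proof (cases "U = {}")
      case True
      then show ?thesis by (simp add: nb_def indep_def)
    next
      case False
      then obtain u where u: "u \<in> U" "card (nb E U u) \<le> k"
          "card (forbidden E V U u) < 2 ^ (t - card (nb E U u))"
        using sel psubset.prems by blast
      let ?U = "U - {u}"
      have nbu: "nb E ?U u = nb E U u" using E(2) by (auto simp: nb_def irrefl_def)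
      have le: "card (nb E ?U w) \<le> card (nb E U w)" for w
        using psubset.hyps by (intro card_mono) (auto simp: nb_def)
      \<comment> \<open>Only \<open>u\<close> is new outside, and \<open>sel\<close> bounds its
        neighbours too.\<close>
      have cap: "\<forall>w\<in>V - ?U. card (nb E ?U w) \<le> k"
      proof
        fix w assume "w \<in> V - ?U"
        then consider "w = u" | "w \<in> V - U" by blast
        then show "card (nb E ?U w) \<le> k"
          using le[of w] nbu u(2) psubset.prems(2) by cases (auto intro: le_trans)
      qed
      have sub: "?U \<subset> U" "?U \<subseteq> V" using u(1) psubset.prems(1) by auto
      obtain f where f: "\<forall>v\<in>?U. f v \<subseteq> {..<t}"
          "\<forall>u\<in>?U. \<forall>v\<in>?U. (u, v) \<in> E \<longrightarrow> (odd (card (f u \<inter> f v)) \<longleftrightarrow> \<pi> u v)"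
          "\<forall>w\<in>V - ?U. indep f (nb E ?U w)"
        using psubset.IH[OF sub cap] by (elim exE conjE)
      have nbf: "finite (nb E U u)" "nb E U u \<subseteq> ?U"
        using psubset.hyps E(2) by (auto simp: nb_def irrefl_def)
      define S where "S = {x \<in> Pow {..<t}. \<forall>v\<in>nb E U u. odd (card (x \<inter> f v)) \<longleftrightarrow> \<pi> u v}"
      have "card S * 2 ^ card (nb E U u) = 2 ^ t"
      proof -
        have "indep f (nb E U u)" using bspec[OF f(3), of u] u(1) psubset.prems(1) nbu by auto
        then show ?thesis
          using card_solutions[OF nbf(1) finite_lessThan[of t], of f "\<pi> u"] f(1) nbf(2)
          unfolding S_def by (metis card_lessThan subset_eq)
      qed
      also have "(2::nat) ^ t = 2 ^ (t - card (nb E U u)) * 2 ^ card (nb E U u)"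
        using u(2) \<open>k \<le> t\<close> by (simp flip: power_add)
      finally have "card S = 2 ^ (t - card (nb E U u))" by simp
      moreover have "finite (nb E U w)" for w using psubset.hyps by (simp add: nb_def)
      then have "finite (forbidden E V U u)" using V by (simp add: forbidden_def)
      then have "card (vsum f ` forbidden E V U u) \<le> card (forbidden E V U u)"
          "finite (vsum f ` forbidden E V U u)"
        by (simp_all add: card_image_le)
      \<comment> \<open>There are more vectors with the right scalar products than forbidden
        sums.\<close>
      ultimately have "\<not> S \<subseteq> vsum f ` forbidden E V U u"
        using u(3) card_mono by (metis leD le_trans)
      then obtain x where x: "x \<in> S" "x \<notin> vsum f ` forbidden E V U u" by blast
      let ?f = "f(u := x)"
      have "\<forall>v\<in>U. ?f v \<subseteq> {..<t}" using f(1) x(1) by (auto simp: S_def)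
      moreover have "odd (card (?f a \<inter> ?f b)) \<longleftrightarrow> \<pi> a b" if ab: "a \<in> U" "b \<in> U" "(a, b) \<in> E" for a b
      proof -
        have ba: "(b, a) \<in> E" using ab E(1) by (meson symD)
        have "a \<noteq> b" using ab E(2) by (auto simp: irrefl_def)
        then consider "a = u" "b \<noteq> u" | "b = u" "a \<noteq> u" | "a \<noteq> u" "b \<noteq> u" by blast
        then show ?thesis
        proof cases
          case 1
          then have "b \<in> nb E U u" using ab by (simp add: nb_def)
          then show ?thesis using 1 x(1) by (simp add: S_def)
        next
          case 2
          then have "a \<in> nb E U u" using ab ba by (simp add: nb_def)
          then have "odd (card (x \<inter> f a)) \<longleftrightarrow> \<pi> u a" using x(1) by (simp add: S_def)
          then show ?thesis using 2 \<pi>[OF ab(3)] by (simp add: Int_commute)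
        next
          case 3
          then show ?thesis using f(2) ab by simp
        qed
      qed
      moreover have "indep ?f (nb E U w)" if w: "w \<in> V - U" for w
        unfolding indep_def
      proof (intro allI impI notI)
        fix J assume J: "J \<subseteq> nb E U w" "J \<noteq> {}" and 0: "vsum ?f J = {}"
        have "finite J" using J(1) psubset.hyps by (auto simp: nb_def intro: finite_subset)
        show False
        proof (cases "u \<in> J")
          case True
          \<comment> \<open>Modulo 2, a vanishing sum containing \<open>x\<close> says that
            \<open>x\<close> is the sum of the other vectors.\<close>
          have "x = vsum f (J - {u})"
            using 0 vsum_update[OF \<open>finite J\<close> True, of f x] by blast
          moreover have "J - {u} \<in> forbidden E V U u"
            using J True w unfolding forbidden_def nb_def by blast
          ultimately show False using x(2) by blast
        next
          case False
          then have "J \<subseteq> nb E ?U w" using J(1) by (auto simp: nb_def)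
          moreover have "vsum ?f J = vsum f J" using False by (intro vsum_cong) auto
          moreover have "indep f (nb E ?U w)" using f(3) w by blast
          ultimately show False using 0 J(2) unfolding indep_def by metis
        qed
      qed
      ultimately show ?thesis by blast
    qed
  qed
  \<comment> \<open>For \<open>U = V\<close> no vertex is outside and the bound by \<open>k\<close>
    is vacuous.\<close>
  from this[of V] obtain f :: "'a \<Rightarrow> nat set" where f: "\<forall>v\<in>V. f v \<subseteq> {..<t}"
      "\<forall>u\<in>V. \<forall>v\<in>V. (u, v) \<in> E \<longrightarrow> (odd (card (f u \<inter> f v)) \<longleftrightarrow> \<pi> u v)"
    by auto
  show thesis
  proof (rule that)
    show "f v \<subseteq> {..<t}" if "v \<in> V" for v using f(1) that by blast
    show "odd (card (f u \<inter> f v)) \<longleftrightarrow> \<pi> u v" if "u \<in> V" "v \<in> V" "(u, v) \<in> E" for u v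
      using f(2) that by simp
  qed
qed

section \<open>A vertex with few neighbours and few forbidden vectors\<close>

lemma card_arcs_within:
  assumes "finite U"
  shows "card (E \<inter> U \<times> U) = (\<Sum>u\<in>U. card (nb E U u))"
proof -
  have "E \<inter> U \<times> U = Sigma U (nb E U)" by (auto simp: nb_def)
  then show ?thesis using assms by (simp add: nb_def)
qed

lemma card_arcs_between:
  assumes "finite U" "finite W" "U \<inter> W = {}" "sym E"
  shows "card (E \<inter> (U \<times> W \<union> W \<times> U)) = 2 * (\<Sum>w\<in>W. card (nb E U w))"
proof -
  have eq: "E \<inter> (U \<times> W \<union> W \<times> U) = Sigma W (nb E U) \<union> (Sigma W (nb E U))\<inverse>"
    using \<open>sym E\<close> by (auto simp: nb_def dest: symD)
  have fin: "finite (Sigma W (nb E U))" using assms by (auto simp: nb_def)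
  have "Sigma W (nb E U) \<inter> (Sigma W (nb E U))\<inverse> = {}" using assms(3) by (auto simp: nb_def)
  then show ?thesis
    using assms fin by (simp add: eq card_Un_disjoint nb_def)
qed

text \<open>The empty set is counted once. A vertex with two neighbours adds one singleton,
  determined by its pair, so equal pairs count once; a vertex with \<open>k \<ge> 3\<close>
  neighbours adds at most \<open>2 ^ (k - 1) - 1\<close> nonempty sets.\<close>

lemma card_forbidden_le:
  assumes "finite V" "U \<subseteq> V" "u \<in> U"
  shows "card (forbidden E V U u) \<le> 1 + card {P \<in> nb E U ` {w \<in> V - U. card (nb E U w) = 2}. u \<in> P}
     + (\<Sum>w\<in>{w \<in> V - U. 3 \<le> card (nb E U w) \<and> u \<in> nb E U w}. 2 ^ (card (nb E U w) - 1) - 1)"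
    (is "_ \<le> 1 + card ?P + sum ?c ?W")
proof -
  have fin: "finite U" "finite (nb E U w)" for w using assms by (auto simp: nb_def intro: finite_subset)
  have "J \<in> {{}} \<union> (\<lambda>P. P - {u}) ` ?P \<union> (\<Union>w\<in>?W. Pow (nb E U w - {u}) - {{}})"
    if J: "J \<in> forbidden E V U u" for J
  proof -
    obtain w where w: "w \<in> V - U" "(w, u) \<in> E" "J \<subseteq> nb E U w - {u}"
      using J by (auto simp: forbidden_def)
    have uw: "u \<in> nb E U w" using w assms(3) by (simp add: nb_def)
    then have "card (nb E U w) \<noteq> 0" using fin by auto
    then consider "card (nb E U w) = 1" | "card (nb E U w) = 2" | "3 \<le> card (nb E U w)" by linarith
    then show ?thesis
    proof cases
      case 1
      then have "nb E U w - {u} = {}" using uw by (metis Diff_cancel card_1_singletonE singletonD)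
      then show ?thesis using w by auto
    next
      case 2
      then have "card (nb E U w - {u}) = 1" using uw by simp
      then obtain a where "nb E U w - {u} = {a}" by (metis card_1_singletonE)
      then have "J = {} \<or> J = nb E U w - {u}" using w(3) by auto
      moreover have "nb E U w \<in> ?P" using w 2 uw by blast
      ultimately show ?thesis by blast
    next
      case 3
      then show ?thesis using w uw by blast
    qed
  qed
  then have sub: "forbidden E V U u \<subseteq> {{}} \<union> (\<lambda>P. P - {u}) ` ?P \<union> (\<Union>w\<in>?W. Pow (nb E U w - {u}) - {{}})"
    by blast
  have finPW: "finite ?P" "finite ?W" using assms by auto
  have "card (forbidden E V U u) \<le> card ({{}} \<union> (\<lambda>P. P - {u}) ` ?P \<union> (\<Union>w\<in>?W. Pow (nb E U w - {u}) - {{}}))"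
    using finPW fin by (intro card_mono[OF _ sub]) auto
  also have "\<dots> \<le> card ({{}} \<union> (\<lambda>P. P - {u}) ` ?P) + card (\<Union>w\<in>?W. Pow (nb E U w - {u}) - {{}})"
    by (rule card_Un_le)
  also have "\<dots> \<le> (1 + card ((\<lambda>P. P - {u}) ` ?P)) + (\<Sum>w\<in>?W. card (Pow (nb E U w - {u}) - {{}}))"
    using card_Un_le[of "{{}}" "(\<lambda>P. P - {u}) ` ?P"]
      card_UN_le[OF finPW(2), of "\<lambda>w. Pow (nb E U w - {u}) - {{}}"] by simp
  also have "\<dots> \<le> (1 + card ?P) + sum ?c ?W"
  proof (intro add_mono sum_mono)
    show "card ((\<lambda>P. P - {u}) ` ?P) \<le> card ?P" using finPW by (intro card_image_le)
    fix w assume "w \<in> ?W"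
    then show "card (Pow (nb E U w - {u}) - {{}}) \<le> ?c w"
      using fin by (simp add: card_Pow)
  qed simp
  finally show ?thesis .
qed

text \<open>A vertex with \<open>k\<close> neighbours in \<open>U\<close> contributes \<open>2 (k - 3)\<close> to twice the Euler bound of
  girth three and \<open>k - 2\<close> to the one of girth four, here taken with the factor \<open>1 / 4\<close>. The weight
  splits the total evenly among the \<open>k\<close> neighbours.\<close>

definition weight :: "nat \<Rightarrow> real" where
  "weight k = (2 * (real k - 3) + (real k - 2) / 4) / real k"

text \<open>The constant 36 gives equality for \<open>k = 3\<close>. The inequality fails for
  \<open>k = 7\<close>, hence the cap of six neighbours.\<close>

lemma weight_ge:
  assumes "3 \<le> k" "k \<le> 6"
  shows "real (2 ^ (k - 1) - 1) / 36 \<le> weight k"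
proof -
  consider "k = 3" | "k = 4" | "k = 5" | "k = 6" using assms by linarith
  then show ?thesis by cases (simp_all add: weight_def)
qed

text \<open>The tightest case is \<open>d = 6\<close>, with value 7.75. With 11 in place of 12 the
  cases 5 and 6 would fail.\<close>

lemma linear_forbidden_bound:
  fixes d :: nat
  assumes "d \<le> 6"
  shows "7 \<le> real d + (2 ^ (12 - d) - 1) / 36"
proof -
  consider "d = 0" | "d = 1" | "d = 2" | "d = 3" | "d = 4" | "d = 5" | "d = 6" using assms by linarith
  then show ?thesis by cases simp_all
qed

section \<open>Euler bounds for the three counts\<close>

lemma planar_bipartite_bound:
  assumes G: "pair_graph G" "planar G" and U: "U \<subseteq> pverts G" "U \<noteq> {}"
    and W: "W \<subseteq> pverts G" "U \<inter> W = {}"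
  shows "(\<Sum>w\<in>W. card (nb (parcs G) U w)) < 2 * (card U + card W)"
proof -
  let ?E = "parcs G" and ?F = "parcs G \<inter> (U \<times> W \<union> W \<times> U)"
  note pg = pair_graphD[OF G(1)]
  have fin: "finite U" "finite W" using U W pg(1) finite_subset by blast+
  have "sym ?F" using pg(3) by (auto simp: sym_def)
  \<comment> \<open>A bipartite graph has no triangle, so girth four is available.\<close>
  have "4 \<le> length p" if p: "3 \<le> length p" "successively (\<lambda>a b. (a, b) \<in> ?F) p" "(last p, hd p) \<in> ?F" for p
  proof (rule ccontr)
    assume "\<not> 4 \<le> length p"
    then have "length p = 3" using p by simp
    then obtain a b c where "p = [a, b, c]" by (auto simp: length_Suc_conv numeral_eq_Suc)
    then show False using p W(2) by auto
  qed
  then have "(4 - 2) * card ?F < 2 * 4 * card (U \<union> W)"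
    using U W \<open>sym ?F\<close> by (intro planar_edge_bound[OF G]) auto
  then show ?thesis
    using card_arcs_between[OF fin W(2) pg(3)] fin W(2) by (simp add: card_Un_disjoint)
qed

lemma card_two_set_eq:
  assumes "card A = 2" "a \<in> A" "b \<in> A" "a \<noteq> b"
  shows "A = {a, b}"
proof -
  have "finite A" using assms(1) card.infinite by fastforce
  then have "{a, b} = A" using assms by (intro card_subset_eq) auto
  then show ?thesis by simp
qed

text \<open>One vertex per pair turns the pairs into the edges of a subdivided simple graph, whose cycles
  have at least six edges.\<close>

lemma planar_pairs_bound:
  assumes G: "pair_graph G" "planar G" and U: "U \<subseteq> pverts G" "U \<noteq> {}"
    and W: "W \<subseteq> pverts G" "U \<inter> W = {}"
  shows "card (nb (parcs G) U ` {w \<in> W. card (nb (parcs G) U w) = 2}) < 3 * card U"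
proof -
  let ?nb = "nb (parcs G) U"
  let ?P = "?nb ` {w \<in> W. card (?nb w) = 2}"
  note pg = pair_graphD[OF G(1)]
  obtain X where X: "X \<subseteq> {w \<in> W. card (?nb w) = 2}" "inj_on ?nb X" "?P = ?nb ` X"
    using subset_image_inj[of ?P ?nb "{w \<in> W. card (?nb w) = 2}"] by auto
  let ?F = "parcs G \<inter> (U \<times> X \<union> X \<times> U)"
  have fin: "finite U" "finite X" using U W X(1) pg(1) finite_subset[of _ "pverts G"] by blast+
  have UX: "U \<inter> X = {}" "X \<subseteq> pverts G" using W X(1) by blast+
  have symF: "sym ?F" using pg(3) by (auto simp: sym_def)
  have bip: "(a \<in> U \<and> b \<in> X \<or> a \<in> X \<and> b \<in> U) \<and> (a \<in> U \<longrightarrow> a \<notin> X) \<and> (b \<in> U \<longrightarrow> b \<notin> X)" if "(a, b) \<in> ?F" for a b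
    using that UX by blast
  \<comment> \<open>Excludes cycles of length four: two representatives with two common neighbours
    in \<open>U\<close> represent the same pair.\<close>
  have same: "b = d" if "b \<in> X" "d \<in> X" "a \<noteq> c" "(a, b) \<in> ?F" "(b, c) \<in> ?F" "(c, d) \<in> ?F" "(d, a) \<in> ?F" for a b c d
  proof -
    have mem: "a \<in> U" "c \<in> U" using that UX by auto
    have "(b, a) \<in> parcs G" "(d, c) \<in> parcs G" using that symF by (auto dest: symD)
    then have "a \<in> ?nb b" "c \<in> ?nb b" "a \<in> ?nb d" "c \<in> ?nb d" using that mem by (auto simp: nb_def)
    moreover have "card (?nb b) = 2" "card (?nb d) = 2" using that X(1) by auto
    ultimately have "?nb b = ?nb d" using card_two_set_eq \<open>a \<noteq> c\<close> by metis
    then show ?thesis using X(2) that by (meson inj_onD)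
  qed
  have "6 \<le> length p" if p: "distinct p" "3 \<le> length p" "successively (\<lambda>a b. (a, b) \<in> ?F) p" "(last p, hd p) \<in> ?F" for p
  proof (rule ccontr)
    assume "\<not> 6 \<le> length p"
    then consider "length p = 3" | "length p = 4" | "length p = 5" using p by linarith
    then show False
    proof cases
      case 1
      then obtain a b c where "p = [a, b, c]" by (auto simp: length_Suc_conv numeral_eq_Suc)
      then show False using p UX(1) by auto
    next
      case 2
      then obtain a b c d where abcd: "p = [a, b, c, d]" by (auto simp: length_Suc_conv numeral_eq_Suc)
      then have F: "(a, b) \<in> ?F" "(b, c) \<in> ?F" "(c, d) \<in> ?F" "(d, a) \<in> ?F" using p by auto
      have "distinct [a, b, c, d]" using p abcd by simp
      moreover have "a \<in> U \<or> a \<in> X" using F by blast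
      ultimately show False
        \<comment> \<open>The cycle may start in \<open>U\<close> or in \<open>X\<close>, so it is
          also read from \<open>c\<close>, or from \<open>b\<close> after a rotation.\<close>
        using same[of b d a c] same[of c a b d] F bip[OF F(1)] bip[OF F(2)] bip[OF F(3)] by auto
    next
      case 3
      then obtain a b c d e where "p = [a, b, c, d, e]" by (auto simp: length_Suc_conv numeral_eq_Suc)
      then have F: "(a, b) \<in> ?F" "(b, c) \<in> ?F" "(c, d) \<in> ?F" "(d, e) \<in> ?F" "(e, a) \<in> ?F" using p by auto
      show False using bip[OF F(1)] bip[OF F(2)] bip[OF F(3)] bip[OF F(4)] bip[OF F(5)] by blast
    qed
  qed
  then have "(6 - 2) * card ?F < 2 * 6 * card (U \<union> X)"
    using U UX symF by (intro planar_edge_bound[OF G]) auto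
  moreover have "(\<Sum>w\<in>X. card (?nb w)) = (\<Sum>w\<in>X. 2)" using X(1) by (intro sum.cong) auto
  then have "card ?F = 4 * card X" using card_arcs_between[OF fin UX(1) pg(3)] by simp
  moreover have "card (U \<union> X) = card U + card X" using fin UX(1) by (simp add: card_Un_disjoint)
  moreover have "card ?P = card X" using X by (simp add: card_image)
  ultimately show ?thesis by simp
qed

text \<open>Twice the bound of girth three for the edges inside \<open>U\<close> and between
  \<open>U\<close> and \<open>W\<close>; the degree sum already counts inner edges twice.\<close>

lemma planar_mixed_bound:
  assumes G: "pair_graph G" "planar G" and U: "U \<subseteq> pverts G" "U \<noteq> {}"
    and W: "W \<subseteq> pverts G" "U \<inter> W = {}"
  shows "(\<Sum>u\<in>U. card (nb (parcs G) U u)) + 2 * (\<Sum>w\<in>W. card (nb (parcs G) U w))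
    < 6 * (card U + card W)"
proof -
  let ?F1 = "parcs G \<inter> U \<times> U" and ?F2 = "parcs G \<inter> (U \<times> W \<union> W \<times> U)"
  note pg = pair_graphD[OF G(1)]
  have fin: "finite U" "finite W" using U W pg(1) finite_subset by blast+
  have "sym (?F1 \<union> ?F2)" using pg(3) by (auto simp: sym_def)
  then have "(3 - 2) * card (?F1 \<union> ?F2) < 2 * 3 * card (U \<union> W)"
    using U W by (intro planar_edge_bound[OF G]) auto
  moreover have "card (?F1 \<union> ?F2) = card ?F1 + card ?F2"
    using W(2) pg(2) by (intro card_Un_disjoint) auto
  ultimately show ?thesis
    using card_arcs_within[OF fin(1)] card_arcs_between[OF fin W(2) pg(3)] fin W(2)
    by (simp add: card_Un_disjoint)
qed

text \<open>If every vertex of \<open>U\<close> failed, \<open>\<phi>\<close> would be at least 7 on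
  all of \<open>U\<close>, while the three planar bounds keep its sum below
  \<open>7 * card U\<close>.\<close>

lemma exists_extendable_vertex:
  assumes G: "pair_graph G" "planar G" and U: "U \<subseteq> pverts G" "U \<noteq> {}"
    and cap: "\<forall>w\<in>pverts G - U. card (nb (parcs G) U w) \<le> 6"
  shows "\<exists>u\<in>U. card (nb (parcs G) U u) \<le> 6 \<and>
    card (forbidden (parcs G) (pverts G) U u) < 2 ^ (12 - card (nb (parcs G) U u))"
proof (rule ccontr)
  assume no: "\<not> ?thesis"
  let ?nb = "nb (parcs G) U"
  let ?P = "?nb ` {w \<in> pverts G - U. card (?nb w) = 2}"
  \<comment> \<open>Vertices with two neighbours in \<open>U\<close> are treated through their
    pairs, since arbitrarily many of them may share a pair.\<close>
  define W where "W = {w \<in> pverts G - U. 3 \<le> card (?nb w)}"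
  note pg = pair_graphD[OF G(1)]
  have fin: "finite U" "finite W" "finite ?P" using pg(1) U(1) finite_subset by (auto simp: W_def)
  have W: "W \<subseteq> pverts G" "U \<inter> W = {}" by (auto simp: W_def)
  \<comment> \<open>Each forbidden set other than the empty one is paid at least 1/36. A pair can be
    paid 1/12: it is shared by two vertices, and fewer than \<open>3 * card U\<close> pairs then
    cost less than 1/2 per vertex.\<close>
  define \<phi> where "\<phi> u = real (card (?nb u)) + card {P \<in> ?P. u \<in> P} / 12
    + (\<Sum>w\<in>{w \<in> W. u \<in> ?nb w}. weight (card (?nb w)))" for u
  have w0: "real (2 ^ (card (?nb w) - 1) - 1) / 36 \<le> weight (card (?nb w))" if "w \<in> W" for w
    using that cap by (intro weight_ge) (auto simp: W_def)
  have "7 \<le> \<phi> u" if u: "u \<in> U" for u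
  proof -
    let ?Wu = "{w \<in> W. u \<in> ?nb w}"
    let ?S = "\<Sum>w\<in>?Wu. 2 ^ (card (?nb w) - 1) - 1"
    have "real ?S / 36 \<le> (\<Sum>w\<in>?Wu. weight (card (?nb w)))"
      using w0 by (simp only: of_nat_sum sum_divide_distrib) (intro sum_mono, simp)
    then have \<phi>: "real (card (?nb u)) + card {P \<in> ?P. u \<in> P} / 12 + real ?S / 36 \<le> \<phi> u"
      by (simp add: \<phi>_def)
    show ?thesis
    proof (cases "card (?nb u) \<le> 6")
      case True
      have "{w \<in> pverts G - U. 3 \<le> card (?nb w) \<and> u \<in> ?nb w} = ?Wu" by (auto simp: W_def)
      then have "card (forbidden (parcs G) (pverts G) U u) \<le> 1 + card {P \<in> ?P. u \<in> P} + ?S"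
        using card_forbidden_le[OF pg(1) U(1) u, of "parcs G"] by simp
      moreover have "2 ^ (12 - card (?nb u)) \<le> card (forbidden (parcs G) (pverts G) U u)"
        using no True u by (meson not_less)
      ultimately have "2 ^ (12 - card (?nb u)) \<le> 1 + card {P \<in> ?P. u \<in> P} + ?S" by (rule order_trans[rotated])
      then have "real (2 ^ (12 - card (?nb u))) \<le> real (1 + card {P \<in> ?P. u \<in> P} + ?S)"
        by (simp only: of_nat_le_iff)
      then have "2 ^ (12 - card (?nb u)) - 1 \<le> real (card {P \<in> ?P. u \<in> P}) + real ?S" by simp
      moreover have "0 \<le> real (card {P \<in> ?P. u \<in> P})" by simp
      ultimately show ?thesis using \<phi> linear_forbidden_bound[OF True] by argo
    next
      \<comment> \<open>Seven neighbours reach the value 7 by themselves.\<close>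
      case False
      then have "7 \<le> real (card (?nb u))" by simp
      moreover have "0 \<le> real (card {P \<in> ?P. u \<in> P})" "0 \<le> real ?S" by (rule of_nat_0_le_iff)+
      ultimately show ?thesis using \<phi> by argo
    qed
  qed
  then have "7 * real (card U) \<le> (\<Sum>u\<in>U. \<phi> u)"
    using sum_bounded_below[of U 7 \<phi>] by (simp add: mult.commute)
  also have "(\<Sum>u\<in>U. \<phi> u) = real (\<Sum>u\<in>U. card (?nb u)) + (\<Sum>u\<in>U. real (card {P \<in> ?P. u \<in> P})) / 12
      + (\<Sum>u\<in>U. \<Sum>w\<in>{w \<in> W. u \<in> ?nb w}. weight (card (?nb w)))"
    by (simp add: \<phi>_def sum.distrib sum_divide_distrib)
  also have "(\<Sum>u\<in>U. real (card {P \<in> ?P. u \<in> P})) = 2 * real (card ?P)"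
  proof -
    have "card {u \<in> U. u \<in> P} = 2" if "P \<in> ?P" for P
    proof -
      have "{u \<in> U. u \<in> P} = P" "card P = 2" using that by (auto simp: nb_def)
      then show ?thesis by simp
    qed
    then have "(\<Sum>u\<in>U. card {P \<in> ?P. u \<in> P}) = (\<Sum>P\<in>?P. 2)"
      using fin by (intro sum_multicount_gen) auto
    then have "real (\<Sum>u\<in>U. card {P \<in> ?P. u \<in> P}) = real (card ?P * 2)" by simp
    then show ?thesis by simp
  qed
  also have "(\<Sum>u\<in>U. \<Sum>w\<in>{w \<in> W. u \<in> ?nb w}. weight (card (?nb w)))
      = (\<Sum>w\<in>W. \<Sum>u\<in>{u \<in> U. u \<in> ?nb w}. weight (card (?nb w)))"
    using fin by (intro sum.swap_restrict)
  \<comment> \<open>Here \<open>k * weight k\<close> is expanded with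
    \<open>k = card (?nb w)\<close>.\<close>
  also have "\<dots> = (\<Sum>w\<in>W. 9 / 4 * real (card (?nb w)) - 13 / 2)"
  proof (rule sum.cong[OF refl])
    fix w assume "w \<in> W"
    then have "card (?nb w) \<noteq> 0" by (simp add: W_def)
    moreover have "{u \<in> U. u \<in> ?nb w} = ?nb w" by (auto simp: nb_def)
    ultimately show "(\<Sum>u\<in>{u \<in> U. u \<in> ?nb w}. weight (card (?nb w))) = 9 / 4 * real (card (?nb w)) - 13 / 2"
      by (simp add: weight_def field_simps)
  qed
  also have "\<dots> = 9 / 4 * real (\<Sum>w\<in>W. card (?nb w)) - 13 / 2 * real (card W)"
    by (simp add: sum_subtractf sum_distrib_left)
  finally have "7 * real (card U) \<le> real (\<Sum>u\<in>U. card (?nb u)) + 2 * real (card ?P) / 12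
      + (9 / 4 * real (\<Sum>w\<in>W. card (?nb w)) - 13 / 2 * real (card W))" .
  moreover have "card ?P < 3 * card U"
    using planar_pairs_bound[OF G U, of "pverts G - U"] by auto
  \<comment> \<open>The bounds enter with coefficients 1, 1/4 and 1/6:
    \<open>6 (n + m) + (n + m) / 2 + n / 2 - 13 m / 2 = 7 n\<close>.\<close>
  moreover have False if "7 * real n \<le> real a + 2 * real p / 12 + (9 / 4 * real b - 13 / 2 * real m)"
      "a + 2 * b < 6 * (n + m)" "b < 2 * (n + m)" "p < 3 * n" for a b m n p :: nat
  proof -
    have "real (a + 2 * b) < real (6 * (n + m))" "real b < real (2 * (n + m))" "real p < real (3 * n)"
      using that(2-4) by (simp_all only: of_nat_less_iff)
    then show ?thesis using that(1) by simp
  qed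
  ultimately show False
    using planar_mixed_bound[OF G U W] planar_bipartite_bound[OF G U W] by blast
qed

section \<open>Inversions\<close>

lemma mem_parcs_inversion:
  "(u, v) \<in> parcs (inversion X D) \<longleftrightarrow> (if u \<in> X \<and> v \<in> X then (v, u) \<in> parcs D else (u, v) \<in> parcs D)"
proof (cases "u \<in> X \<and> v \<in> X")
  case True
  then show ?thesis
    by (auto simp: inversion_def image_iff split: if_splits intro!: bexI[of _ "(v, u)"])
next
  case False
  then show ?thesis
    by (auto simp: inversion_def image_iff split: if_splits intro!: bexI[of _ "(u, v)"])
qed

lemma is_orientation_inversion:
  assumes "sym (parcs G)" "is_orientation G D"
  shows "is_orientation G (inversion X D)"
proof -
  have p: "pverts (inversion X D) = pverts G"
    using assms(2) by (simp add: inversion_def is_orientation_def)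
  have D: "parcs D \<subseteq> parcs G" "\<And>u v. (u, v) \<in> parcs G \<Longrightarrow> (u, v) \<in> parcs D \<longleftrightarrow> (v, u) \<notin> parcs D"
    using assms(2) by (auto simp: is_orientation_def)
  have "parcs (inversion X D) \<subseteq> parcs G"
  proof (rule subrelI)
    fix u v assume "(u, v) \<in> parcs (inversion X D)"
    then have "(u, v) \<in> parcs D \<or> (v, u) \<in> parcs D"
      by (auto simp: mem_parcs_inversion split: if_splits)
    then show "(u, v) \<in> parcs G" using D(1) assms(1) by (meson subsetD symD)
  qed
  moreover have "(u, v) \<in> parcs (inversion X D) \<longleftrightarrow> (v, u) \<notin> parcs (inversion X D)"
    if "(u, v) \<in> parcs G" for u v
    using D(2)[OF that] by (auto simp: mem_parcs_inversion)
  ultimately show ?thesis using p by (auto simp: is_orientation_def)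
qed

fun invert_all :: "(nat \<Rightarrow> 'a set) \<Rightarrow> nat \<Rightarrow> 'a pair_pre_digraph \<Rightarrow> 'a pair_pre_digraph" where
  "invert_all X 0 D = D"
| "invert_all X (Suc n) D = inversion (X n) (invert_all X n D)"

lemma is_orientation_invert_all:
  assumes "sym (parcs G)" "is_orientation G D"
  shows "is_orientation G (invert_all X n D)"
  using assms by (induction n) (simp_all add: is_orientation_inversion)

text \<open>An edge is reversed once for each set containing both ends, so only the parity of their
  number matters.\<close>

lemma mem_parcs_invert_all:
  assumes G: "sym (parcs G)" "is_orientation G D" and uv: "(u, v) \<in> parcs G"
  shows "(u, v) \<in> parcs (invert_all X n D) \<longleftrightarrow>
    ((u, v) \<in> parcs D \<longleftrightarrow> even (card {i. i < n \<and> u \<in> X i \<and> v \<in> X i}))"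
proof (induction n)
  case (Suc n)
  have "(v, u) \<in> parcs (invert_all X n D) \<longleftrightarrow> (u, v) \<notin> parcs (invert_all X n D)"
    using is_orientation_invert_all[OF G, of X n] uv by (auto simp: is_orientation_def)
  moreover have "{i. i < Suc n \<and> u \<in> X i \<and> v \<in> X i} =
    (if u \<in> X n \<and> v \<in> X n then insert n else id) {i. i < n \<and> u \<in> X i \<and> v \<in> X i}"
    by (auto simp: less_Suc_eq)
  ultimately show ?case using Suc by (simp add: mem_parcs_inversion)
qed simp

lemma graph_dist_invert_all_le:
  assumes G: "sym (parcs G)" "is_orientation G D" and X: "\<And>i. X i \<subseteq> pverts G"
  shows "graph_dist (inversion_graph G) D (invert_all X n D) \<le> ereal (real n)"
proof -
  interpret pair_wf_digraph "inversion_graph G" by (rule wf_inversion_graph)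
  have "\<exists>p. awalk D p (invert_all X n D) \<and> length p \<le> n"
  proof (induction n)
    case 0
    have "D \<in> pverts (inversion_graph G)" using G(2) by (simp add: inversion_graph_def)
    then have "awalk D [] D" by (simp add: awalk_Nil_iff)
    then show ?case by (intro exI[of _ "[]"]) simp
  next
    case (Suc n)
    let ?D = "invert_all X n D" and ?D' = "invert_all X (Suc n) D"
    obtain p where p: "awalk D p ?D" "length p \<le> n" using Suc by blast
    show ?case
    \<comment> \<open>An inversion that changes nothing is no arc of the inversion graph and is
      skipped; hence a walk of length at most \<open>n\<close>.\<close>
    proof (cases "?D = ?D'")
      case True
      then show ?thesis using p by (metis le_SucI)
    next
      case False
      then have "(?D, ?D') \<in> parcs (inversion_graph G)"
        using is_orientation_invert_all[OF G, of X n] is_orientation_invert_all[OF G, of X "Suc n"]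
          X[of n] unfolding inversion_graph_def by auto
      then have "awalk ?D [(?D, ?D')] ?D'"
        using arc_implies_awalk by fastforce
      then have "awalk D (p @ [(?D, ?D')]) ?D'" using p(1) awalk_appendI by blast
      then show ?thesis using p(2) by (intro exI[of _ "p @ [(?D, ?D')]"]) simp
    qed
  qed
  then obtain p where p: "awalk D p (invert_all X n D)" "length p \<le> n" by blast
  have "awalk_cost (\<lambda>_. 1) p = real (length p)" by (simp add: awalk_cost_def sum_list_triv)
  then have "graph_dist (inversion_graph G) D (invert_all X n D) \<le> ereal (real (length p))"
    using min_cost_le_walk_cost[OF p(1), of "\<lambda>_. 1"] by (simp add: graph_dist_def)
  also have "\<dots> \<le> ereal (real n)" using p(2) by simp
  finally show ?thesis .
qed

theorem corollary8p5:
  fixes G :: "'a pair_pre_digraph"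
  assumes "pair_graph G" and "planar G"
  shows "diam (inversion_graph G) \<le> 12"
proof -
  note pg = pair_graphD[OF assms(1)]
  have "graph_dist (inversion_graph G) D D' \<le> 12"
    if D: "is_orientation G D" and D': "is_orientation G D'" for D D'
  proof -
    \<comment> \<open>Marks the edges to be reversed; it is symmetric because both digraphs orient
      every edge.\<close>
    let ?\<pi> = "\<lambda>u v. \<not> ((u, v) \<in> parcs D \<longleftrightarrow> (u, v) \<in> parcs D')"
    have "irrefl (parcs G)" using pg(5) by (auto simp: irrefl_def)
    moreover have "?\<pi> u v = ?\<pi> v u" if "(u, v) \<in> parcs G" for u v
      using D D' that by (auto simp: is_orientation_def)
    ultimately obtain f where f: "\<And>v. v \<in> pverts G \<Longrightarrow> f v \<subseteq> {..<12::nat}"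
        "\<And>u v. \<lbrakk>u \<in> pverts G; v \<in> pverts G; (u, v) \<in> parcs G\<rbrakk> \<Longrightarrow> odd (card (f u \<inter> f v)) \<longleftrightarrow> ?\<pi> u v"
      using exists_vector_labelling[OF pg(1) pg(3), of 6 12 ?\<pi>]
        exists_extendable_vertex[OF assms] by simp blast
    \<comment> \<open>The \<open>i\<close>-th coordinates form the \<open>i\<close>-th inversion, so
      \<open>f u \<inter> f v\<close> lists the inversions that reverse the edge.\<close>
    define X where "X i = {v \<in> pverts G. i \<in> f v}" for i
    let ?D = "invert_all X 12 D"
    have mem: "(u, v) \<in> parcs ?D \<longleftrightarrow> (u, v) \<in> parcs D'" if uv: "(u, v) \<in> parcs G" for u v
    proof -
      have "u \<in> pverts G" "v \<in> pverts G" using pg(4) uv by auto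
      moreover from this have "{i. i < 12 \<and> u \<in> X i \<and> v \<in> X i} = f u \<inter> f v"
        using f(1) by (auto simp: X_def)
      ultimately show ?thesis
        using mem_parcs_invert_all[OF pg(3) D uv, of X 12] f(2)[OF _ _ uv] by auto
    qed
    have O: "is_orientation G ?D" using is_orientation_invert_all[OF pg(3) D] .
    have "parcs ?D = parcs D'"
      using mem O D' unfolding is_orientation_def by auto
    moreover have "pverts ?D = pverts D'" using O D' by (simp add: is_orientation_def)
    ultimately have "?D = D'" by simp
    moreover have "X i \<subseteq> pverts G" for i by (auto simp: X_def)
    ultimately show ?thesis
      using graph_dist_invert_all_le[OF pg(3) D, of X 12] by simp
  qed
  then show ?thesis
    unfolding diam_def by (auto simp: inversion_graph_def intro!: SUP_least)
qed

end
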